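(* Let $p\ge3$ be a prime. For all $n,k\ge0$, $$b\!\left(108p^{2\nu(p)k}n+\frac{153p^{2\nu(p)k}-1}{2}\right)\equiv 0\pmod{72}.$$
   Context: The mock theta function $\mathcal{B}(q)=\sum_{n\ge0}\frac{q^n(-q;q^2)_n}{(q;q^2)_{n+1}}=\sum_{n\ge0}b(n)q^n$, $(a;q)_n=\prod_{j=0}^{n-1}(1-aq^j)$. The integers $a(n)$ are defined by $\sum_{n\ge0}a(n)q^n=f_1^4f_2$, $f_m:=(q^m;q^m)_\infty$. For a prime $p\ge3$: $r=r(p):=a\!\left(\frac{p^2-1}{4}\right)+(-1)^{\frac{p-1}{2}}\,p\left(\frac{(p^2-1)/4}{p}\right)$ (Legendre symbol); $r$ is even. Set $\nu(p)=2$ if $r\equiv0\pmod 8$, $\nu(p)=4$ if $r\equiv4\pmod8$, $\nu(p)=8$ if $r\equiv2\pmod4$. *)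

theory Defs
  imports "HOL-Computational_Algebra.Formal_Power_Series" "HOL-Number_Theory.Number_Theory"
begin

definition qpoch :: "'a::comm_ring_1 fps \<Rightarrow> 'a fps \<Rightarrow> nat \<Rightarrow> 'a fps" where
  "qpoch a q m = (\<Prod>j<m. 1 - a * q ^ j)"

definition Bterm :: "nat \<Rightarrow> rat fps" where
  "Bterm j = fps_X ^ j * qpoch (- fps_X) (fps_X ^ 2) j * inverse (qpoch fps_X (fps_X ^ 2) (Suc j))"

text \<open>B(q) = sum_{j>=0} Bterm j; the sum converges formally since Bterm j = O(q^j),
  so the n-th coefficient only involves the summands j \<le> n.\<close>
definition mockB :: "rat fps" where
  "mockB = Abs_fps (\<lambda>n. fps_nth (\<Sum>j\<le>n. Bterm j) n)"

definition b :: "nat \<Rightarrow> rat" where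
  "b n = fps_nth mockB n"

text \<open>f_m = (q^m;q^m)_\<infinity>; the coefficient of q^n in f_1^4 f_2 only involves the factors
  (1 - q^j) with j \<le> n.\<close>
definition a :: "nat \<Rightarrow> int" where
  "a n = fps_nth (\<Prod>j\<in>{1..n}. (1 - fps_X ^ j) ^ 4 * (1 - fps_X ^ (2 * j))) n"

definition r :: "nat \<Rightarrow> int" where
  "r p = a ((p\<^sup>2 - 1) div 4)
         + (-1) ^ ((p - 1) div 2) * int p * Legendre (int ((p\<^sup>2 - 1) div 4)) (int p)"

definition nu :: "nat \<Rightarrow> nat" where
  "nu p = (if r p mod 8 = 0 then 2 else if r p mod 8 = 4 then 4 else 8)"

end

theory Submission
  imports Defs
begin

unbundle fps_syntax

text \<open>Let E(q) be the generating function of b(2n). The sum B(q) + B(-q) is a bilateral series of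
  type 1-psi-1, which a contiguous relation in its denominator parameter evaluates as an infinite
  product; with Gauss' product formulas this becomes E(q) phi(-q) = psi(q)^2, where
  phi(q) is the sum of q^(n^2) over all integers n and psi(q) the sum of q^(k(k+1)/2) over k \<ge> 0.

  Modulo 8: psi(q)^2 = phi(q) psi(q^2). Write phi(q) = e + o with e even, o odd; then
  E (e^2 - o^2) = (e + o)^2 psi(q^2), and 2 o^2 is divisible by 8, so the even part of E is congruent
  to psi(q^2). Hence 8 divides b(4j) unless 8j + 1 is a square.

  Modulo 9: 3-dissecting psi(q) = A + C/2 and phi(-q) = H + 2U, the relation C H = -2 A U turns the
  part of exponents 2 mod 3 of E (H^3 + 8 U^3) into 9 (A U)^2. Hence 9 divides b(6n + 4).

  The index N of the theorem is twice an even m congruent to 2 mod 3 with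
  4m + 1 = 9 p^(2 nu k) (24n + 17), which is not a square because 24n + 17 is 2 mod 3.\<close>

section \<open>Congruence of power series modulo powers of X\<close>

text \<open>The relation links the parameter q^L to q^(L+2), and along odd L and along even L the
  series tends to the same limit. The odd chain starts at L = 1, where the bilateral series is B(q)
  + B(-q). The even chain starts at L = 2, where all terms of index below -1 vanish and the
  q-binomial theorem evaluates what is left; comparing the chains gives the product. No analytic
  limit occurs: each such statement is a congruence modulo X^N between finite products, for
  arbitrary N. Both congruences meet one obstacle: division by phi(-q) mixes residue classes of
  exponents. The remedy is to multiply phi(-q) by its other conjugates under q -> zeta q with zeta^k
  = 1, where k is 2 or 3. The resulting norm has exponents divisible by k and constant term 1, so
  divisibility within one class of exponents survives the division.\<close>

definition ceq :: "nat \<Rightarrow> rat fps \<Rightarrow> rat fps \<Rightarrow> bool" where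
  "ceq N F G \<longleftrightarrow> fps_X ^ N dvd F - G"

lemma X_power_dvd_iff: "fps_X ^ N dvd (F :: rat fps) \<longleftrightarrow> (\<forall>i<N. F $ i = 0)"
proof
  assume "fps_X ^ N dvd F"
  then show "\<forall>i<N. F $ i = 0" by (auto elim!: dvdE simp: fps_X_power_mult_nth)
next
  assume "\<forall>i<N. F $ i = 0"
  then have "F = fps_X ^ N * fps_shift N F"
    by (intro fps_ext) (auto simp: fps_X_power_mult_nth)
  then show "fps_X ^ N dvd F" by (metis dvd_triv_left)
qed

lemma ceq_nth: "ceq N F G \<longleftrightarrow> (\<forall>i<N. F $ i = G $ i)"
  by (simp add: ceq_def X_power_dvd_iff)

lemma ceq_refl [simp]: "ceq N F F"
  by (simp add: ceq_def)

lemma ceq_sym: "ceq N F G \<Longrightarrow> ceq N G F"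
  by (simp add: ceq_nth)

lemma ceq_trans [trans]: "ceq N F G \<Longrightarrow> ceq N G H \<Longrightarrow> ceq N F H"
  by (simp add: ceq_nth)

lemma ceq_add: "ceq N F G \<Longrightarrow> ceq N F' G' \<Longrightarrow> ceq N (F + F') (G + G')"
  by (simp add: ceq_nth)

lemma ceq_mult:
  assumes "ceq N F G" "ceq N F' G'" shows "ceq N (F * F') (G * G')"
proof -
  have "F * F' - G * G' = (F - G) * F' + G * (F' - G')" by (simp add: algebra_simps)
  then show ?thesis using assms by (auto simp: ceq_def intro: dvd_add dvd_mult dvd_mult2)
qed

lemma ceq_multl: "ceq N F G \<Longrightarrow> ceq N (H * F) (H * G)"
  by (intro ceq_mult) auto

lemma ceq_sum: "(\<And>x. x \<in> A \<Longrightarrow> ceq N (f x) (g x)) \<Longrightarrow> ceq N (sum f A) (sum g A)"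
  by (simp add: ceq_nth fps_sum_nth)

lemma ceq_prod: "(\<And>x. x \<in> A \<Longrightarrow> ceq N (f x) (g x)) \<Longrightarrow> ceq N (prod f A) (prod g A)"
  by (induction A rule: infinite_finite_induct) (auto intro: ceq_mult)

lemma ceq_cancel:
  assumes "ceq N (H * F) (H * G)" "H $ 0 \<noteq> 0" shows "ceq N F G"
proof -
  have "ceq N (inverse H * (H * F)) (inverse H * (H * G))"
    using assms(1) by (rule ceq_multl)
  then show ?thesis
    using inverse_mult_eq_1[OF assms(2)] by (simp flip: mult.assoc)
qed

lemma ceq_eqI: "(\<And>N. ceq N F G) \<Longrightarrow> F = G"
  by (metis ceq_nth fps_ext lessI)

lemma ceq_one_add: "N \<le> m \<Longrightarrow> ceq N (1 + fps_X ^ m) 1"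
  by (simp add: ceq_nth)

lemma ceq_one_diff: "N \<le> m \<Longrightarrow> ceq N (1 - fps_X ^ m) 1"
  by (simp add: ceq_nth)

text \<open>Cross-multiplied iteration of F k = (v k / u k) F (k + 1): no inverse of an infinite
  product is ever formed.\<close>

lemma ceq_iterate:
  assumes "\<And>k. ceq N (u k * F k) (v k * F (Suc k))"
  shows "ceq N ((\<Prod>k<K. u k) * F 0) ((\<Prod>k<K. v k) * F K)"
proof (induction K)
  case (Suc K)
  have "ceq N (u K * ((\<Prod>k<K. u k) * F 0)) (u K * ((\<Prod>k<K. v k) * F K))"
    by (rule ceq_multl[OF Suc])
  also have "ceq N \<dots> ((\<Prod>k<K. v k) * (v K * F (Suc K)))"
    using ceq_multl[OF assms, of "\<Prod>k<K. v k"] by (simp add: mult_ac)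
  finally show ?case by (simp add: mult_ac)
qed simp

lemma fps_prod_nth_0: "(\<Prod>x\<in>A. f x) $ 0 = (\<Prod>x\<in>A. (f x :: rat fps) $ 0)"
  by (induction A rule: infinite_finite_induct) auto

section \<open>The bilateral series\<close>

definition oddp :: "nat \<Rightarrow> rat fps" where
  "oddp n = (\<Prod>j<n. 1 + fps_X ^ (2 * j + 1))"

definition stepp :: "nat \<Rightarrow> nat \<Rightarrow> rat fps" where
  "stepp L n = (\<Prod>j<n. 1 - fps_X ^ (L + 2 * j))"

lemma oddp_0 [simp]: "oddp 0 = 1" and oddp_Suc: "oddp (Suc n) = oddp n * (1 + fps_X ^ (2 * n + 1))"
  by (simp_all add: oddp_def)

lemma stepp_0 [simp]: "stepp L 0 = 1"
  and stepp_Suc: "stepp L (Suc n) = stepp L n * (1 - fps_X ^ (L + 2 * n))"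
  by (simp_all add: stepp_def)

lemma stepp_Suc_shift: "stepp L (Suc n) = (1 - fps_X ^ L) * stepp (L + 2) n"
proof (induction n)
  case (Suc n)
  show ?case unfolding stepp_Suc[of L "Suc n"] Suc stepp_Suc[of "L + 2" n] by (simp add: mult_ac)
qed (simp add: stepp_Suc)

lemma oddp_nth_0 [simp]: "oddp n $ 0 = 1"
  by (simp add: oddp_def fps_prod_nth_0)

lemma stepp_nth_0 [simp]: "L > 0 \<Longrightarrow> stepp L n $ 0 = 1"
  by (simp add: stepp_def fps_prod_nth_0)

lemma one_add_X_power_neq_0: "(1 + fps_X ^ m :: rat fps) \<noteq> 0"
proof
  assume "(1 + fps_X ^ m :: rat fps) = 0"
  then have "(1 + fps_X ^ m :: rat fps) $ 0 = 0" by simp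
  then show False by (cases m) auto
qed

lemma one_diff_X_power_neq_0:
  assumes "m > 0" shows "(1 - fps_X ^ m :: rat fps) \<noteq> 0"
proof
  assume "(1 - fps_X ^ m :: rat fps) = 0"
  then have "(1 - fps_X ^ m :: rat fps) $ 0 = 0" by simp
  then show False using assms by simp
qed

text \<open>Strips the last factor \<open>G\<close> from an inverted finite product
  \<open>H\<close>. Ratios of consecutive summands are read off this way, since power series do not
  form a field.\<close>

lemma mult_inverse_cancel:
  assumes "F * G = H" "H $ 0 \<noteq> 0" shows "inverse H * G = inverse (F :: rat fps)"
proof -
  have "G $ 0 \<noteq> 0" using assms by auto
  then have "inverse G * G = 1" by (rule inverse_mult_eq_1)
  then show ?thesis unfolding assms(1)[symmetric] by (simp add: fps_inverse_mult mult.assoc)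
qed

definition posterm :: "nat \<Rightarrow> nat \<Rightarrow> rat fps" where
  "posterm L n = fps_X ^ n * oddp n * inverse (stepp L (Suc n))"

text \<open>By reflection, (-q;q^2)_(-n-1) = q^((n+1)^2) / \<open>oddp (Suc n)\<close> and 1 /
  (q^L;q^2)_(-n) is the product of 1 - q^(L-2j) for j = 1..n. The leftover power q^(n(n+1)) is
  distributed as q^(2j) over these factors, so that no negative exponent remains.\<close>

definition negterm :: "nat \<Rightarrow> nat \<Rightarrow> rat fps" where
  "negterm L n = (\<Prod>j<n. fps_X ^ (2 * j + 2) - fps_X ^ L) * inverse (oddp (Suc n))"

lemma posterm_Suc:
  assumes "L > 0"
  shows "posterm L (Suc n) * (1 - fps_X ^ (L + 2 * n + 2)) = fps_X * (1 + fps_X ^ (2 * n + 1)) * posterm L n"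
proof -
  have "inverse (stepp L (Suc (Suc n))) * (1 - fps_X ^ (L + 2 * n + 2)) = inverse (stepp L (Suc n))"
    by (rule mult_inverse_cancel) (use assms in \<open>simp_all add: stepp_Suc[of L "Suc n"]\<close>)
  then show ?thesis unfolding posterm_def oddp_Suc \<open>_ = inverse (stepp L (Suc n))\<close>[symmetric]
    by (simp only: power_Suc mult_ac)
qed

lemma posterm_shift:
  assumes "L > 0"
  shows "posterm (L + 2) n * (1 - fps_X ^ (L + 2 * n + 2)) = (1 - fps_X ^ L) * posterm L n"
proof -
  have 1: "inverse (stepp L (Suc (Suc n))) * (1 - fps_X ^ (L + 2 * n + 2)) = inverse (stepp L (Suc n))"
    by (rule mult_inverse_cancel) (use assms in \<open>simp_all add: stepp_Suc[of L "Suc n"]\<close>)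
  have 2: "inverse (stepp L (Suc (Suc n))) * (1 - fps_X ^ L) = inverse (stepp (L + 2) (Suc n))"
    by (rule mult_inverse_cancel) (use assms in \<open>simp_all add: stepp_Suc_shift[of L "Suc n"]\<close>)
  show ?thesis unfolding posterm_def 1[symmetric] 2[symmetric] by (simp only: mult_ac)
qed

text \<open>The next summand and the summand for L + 2 are both multiples of
  \<open>posterm L n\<close> with the same denominator 1 - q^(L+2n+2). Clearing it leaves a
  polynomial identity in c = q^L, y = q^(2n) and q.\<close>

lemma posterm_telescope:
  assumes "L > 0"
  shows "(1 - fps_X ^ (2 * L)) * posterm L n - (1 + fps_X ^ (L + 1)) * posterm (L + 2) n
    = - (fps_X ^ L * (1 - fps_X ^ L)) * (posterm L (Suc n) - posterm L n)"
    (is "?l = ?r")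
proof -
  define w :: "rat fps" where "w = 1 - fps_X ^ (L + 2 * n + 2)"
  define c :: "rat fps" where "c = fps_X ^ L"
  define y :: "rat fps" where "y = fps_X ^ (2 * n)"
  have w: "w = 1 - c * y * fps_X ^ 2" by (simp add: w_def c_def y_def power_add power2_eq_square)
  have w0: "w \<noteq> 0" unfolding w_def by (rule one_diff_X_power_neq_0) simp
  have S: "posterm L (Suc n) * w = fps_X * (1 + fps_X * y) * posterm L n"
    using posterm_Suc[OF assms, of n] by (simp add: w_def y_def)
  have T: "posterm (L + 2) n * w = (1 - c) * posterm L n"
    using posterm_shift[OF assms, of n] by (simp add: w_def c_def)
  have l: "?l = (1 - c ^ 2) * posterm L n - (1 + c * fps_X) * posterm (L + 2) n"
    by (simp add: c_def power_mult mult.commute power2_eq_square mult_2 power_add)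
  have "?l * w = (1 - c ^ 2) * posterm L n * w - (1 + c * fps_X) * ((1 - c) * posterm L n)"
    unfolding l T[symmetric] by (simp add: algebra_simps)
  also have "\<dots> = - (c * (1 - c)) * (fps_X * (1 + fps_X * y) * posterm L n - posterm L n * w)"
    unfolding w by (simp add: algebra_simps power2_eq_square)
  also have "\<dots> = ?r * w"
    unfolding S[symmetric] by (simp add: algebra_simps c_def)
  finally have "?l * w = ?r * w" .
  then show ?thesis using mult_right_cancel[OF w0] by blast
qed

lemma negterm_0: "negterm L 0 = inverse (1 + fps_X)"
  by (simp add: negterm_def oddp_Suc)

lemma inverse_oddp_Suc:
  "inverse (oddp (Suc n)) * (1 + fps_X ^ (2 * n + 1)) = inverse (oddp n)"
  by (rule mult_inverse_cancel) (simp_all add: oddp_Suc)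

lemma negterm_Suc:
  "negterm L (Suc n) * (1 + fps_X ^ (2 * n + 3)) = (fps_X ^ (2 * n + 2) - fps_X ^ L) * negterm L n"
  using inverse_oddp_Suc[of "Suc n"] by (simp add: negterm_def eval_nat_numeral mult_ac)

text \<open>Raising L by 2 moves the product by one index: the new factor j + 1 is X^2 times the old
  factor j, and the new factor 0 is X^2 (1 - X^L).\<close>

lemma prod_shift:
  "(\<Prod>j<Suc n. fps_X ^ (2 * j + 2) - fps_X ^ (L + 2) :: rat fps)
    = fps_X ^ (2 * n + 2) * (1 - fps_X ^ L) * (\<Prod>j<n. fps_X ^ (2 * j + 2) - fps_X ^ L)"
proof (induction n)
  case (Suc n)
  show ?case unfolding prod.lessThan_Suc[of _ "Suc n"] Suc
    by (simp add: algebra_simps power_add power2_eq_square)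
qed (simp add: algebra_simps power_add)

lemma negterm_shift:
  "negterm (L + 2) (Suc n) * (1 + fps_X ^ (2 * n + 3))
    = fps_X ^ (2 * n + 2) * (1 - fps_X ^ L) * negterm L n"
  using inverse_oddp_Suc[of "Suc n"] unfolding negterm_def prod_shift
  by (simp add: eval_nat_numeral mult_ac)

text \<open>The difference of \<open>posterm_telescope\<close> continued to negative indices; the
  sign changes because n now runs downwards. The neighbour of index -1 is
  \<open>posterm L 0\<close>, so that index is treated separately in
  \<open>bilat_contiguous\<close>.\<close>

lemma negterm_telescope:
  "(1 - fps_X ^ (2 * L)) * negterm L (Suc n) - (1 + fps_X ^ (L + 1)) * negterm (L + 2) (Suc n)
    = fps_X ^ L * (1 - fps_X ^ L) * (negterm L (Suc n) - negterm L n)"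
    (is "?l = ?r")
proof -
  define w :: "rat fps" where "w = 1 + fps_X ^ (2 * n + 3)"
  define c :: "rat fps" where "c = fps_X ^ L"
  define y :: "rat fps" where "y = fps_X ^ (2 * n + 2)"
  have w: "w = 1 + fps_X * y" by (simp add: w_def y_def eval_nat_numeral)
  have w0: "w \<noteq> 0" unfolding w_def by (rule one_add_X_power_neq_0)
  have S: "negterm L (Suc n) * w = (y - c) * negterm L n"
    using negterm_Suc[of L n] by (simp add: w_def y_def c_def)
  have T: "negterm (L + 2) (Suc n) * w = y * (1 - c) * negterm L n"
    using negterm_shift[of L n] by (simp add: w_def c_def y_def)
  have l: "?l = (1 - c ^ 2) * negterm L (Suc n) - (1 + c * fps_X) * negterm (L + 2) (Suc n)"
    by (simp add: c_def power2_eq_square mult_2 power_add)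
  have "?l * w = (1 - c ^ 2) * ((y - c) * negterm L n) - (1 + c * fps_X) * (y * (1 - c) * negterm L n)"
    unfolding l T[symmetric] S[symmetric] by (simp add: algebra_simps)
  also have "\<dots> = c * (1 - c) * ((y - c) * negterm L n - negterm L n * w)"
    unfolding w by (simp add: algebra_simps power2_eq_square)
  also have "\<dots> = ?r * w"
    unfolding S[symmetric] by (simp add: algebra_simps c_def)
  finally have "?l * w = ?r * w" .
  then show ?thesis using mult_right_cancel[OF w0] by blast
qed

text \<open>The symmetric partial sums of the bilateral series
  sum over all integers n of q^n (-q;q^2)_n / (q^L;q^2)_{n+1}:
  \<open>negterm L n\<close> is the summand of index -n-1.\<close>
definition bilat :: "nat \<Rightarrow> nat \<Rightarrow> rat fps" where
  "bilat N L = (\<Sum>n\<le>N. posterm L n) + (\<Sum>n\<le>N. negterm L n)"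

lemma negterm_dvd:
  assumes "L > 0" shows "fps_X ^ n dvd negterm L n"
proof -
  have "(\<Prod>j<n. fps_X :: rat fps) dvd (\<Prod>j<n. fps_X ^ (2 * j + 2) - fps_X ^ L)"
    using assms by (intro prod_dvd_prod) (auto intro!: dvd_diff dvd_power)
  then show ?thesis by (simp add: negterm_def)
qed

lemma bilat_contiguous:
  assumes "L > 0"
  shows "ceq N ((1 - fps_X ^ (2 * L)) * bilat N L) ((1 + fps_X ^ (L + 1)) * bilat N (L + 2))"
proof -
  define c :: "rat fps" where "c = fps_X ^ L"
  let ?u = "1 - fps_X ^ (2 * L) :: rat fps" and ?v = "1 + fps_X ^ (L + 1) :: rat fps"
  have u: "?u = 1 - c ^ 2" and v: "?v = 1 + c * fps_X"
    by (simp_all add: c_def power2_eq_square mult_2 power_add)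
  have i1: "inverse (1 + fps_X) * (1 + fps_X) = (1 :: rat fps)"
    by (rule inverse_mult_eq_1) simp
  \<comment> \<open>At the junction of indices -1 and 0 the nonnegative half leaves c and the
    negative half leaves -c. These cancel, and the outer boundary terms are divisible by
    X^N.\<close>
  have pos: "(\<Sum>n\<le>N. ?u * posterm L n - ?v * posterm (L + 2) n)
      = c - c * (1 - c) * posterm L (Suc N)"
  proof -
    have p0: "posterm L 0 * (1 - c) = 1"
      using inverse_mult_eq_1[of "1 - c"] assms by (simp add: posterm_def stepp_Suc c_def)
    have "(\<Sum>n\<le>N. ?u * posterm L n - ?v * posterm (L + 2) n)
        = - (c * (1 - c)) * (\<Sum>n\<le>N. posterm L (Suc n) - posterm L n)"
      unfolding posterm_telescope[OF assms] c_def by (simp add: sum_distrib_left)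
    also have "(\<Sum>n\<le>N. posterm L (Suc n) - posterm L n) = posterm L (Suc N) - posterm L 0"
      by (induction N) auto
    also have "- (c * (1 - c)) * (posterm L (Suc N) - posterm L 0)
        = c * (posterm L 0 * (1 - c)) - c * (1 - c) * posterm L (Suc N)"
      by (simp add: algebra_simps)
    finally show ?thesis unfolding p0 by simp
  qed
  have neg: "(\<Sum>n\<le>N. ?u * negterm L n - ?v * negterm (L + 2) n) = c * (1 - c) * negterm L N - c"
  proof (induction N)
    case 0
    have "?u * negterm L 0 - ?v * negterm (L + 2) 0
        = c * (1 - c) * negterm L 0 - c * (inverse (1 + fps_X) * (1 + fps_X))"
      unfolding u v negterm_0 by (simp add: algebra_simps power2_eq_square)
    then show ?case unfolding i1 by simp
  next
    case (Suc N)
    show ?case unfolding sum.atMost_Suc Suc negterm_telescope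
      by (simp add: c_def algebra_simps)
  qed
  have "?u * bilat N L - ?v * bilat N (L + 2)
      = (\<Sum>n\<le>N. ?u * posterm L n - ?v * posterm (L + 2) n)
        + (\<Sum>n\<le>N. ?u * negterm L n - ?v * negterm (L + 2) n)"
    by (simp add: bilat_def sum_subtractf distrib_left flip: sum_distrib_left)
  also have "\<dots> = c * (1 - c) * (negterm L N - posterm L (Suc N))"
    unfolding pos neg by (simp add: algebra_simps)
  also have "fps_X ^ N dvd \<dots>"
    using negterm_dvd[OF assms, of N]
    by (intro dvd_mult dvd_diff) (auto simp: posterm_def intro!: dvd_mult2 le_imp_power_dvd)
  finally show ?thesis by (simp add: ceq_def)
qed

lemma ceq_inverse_1:
  assumes "ceq N F 1" "F $ 0 \<noteq> 0" shows "ceq N (inverse F) 1"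
proof (rule ceq_cancel)
  show "ceq N (F * inverse F) (F * 1)"
    using assms inverse_mult_eq_1'[of F] by (simp add: ceq_sym)
qed (fact assms(2))

text \<open>Once L is at least N, every power X^L vanishes modulo X^N, so the limit does not see the
  parity of L. This is what ties the odd chain to the even one.\<close>

lemma bilat_stable:
  assumes "N \<le> L" "L > 0"
  shows "ceq N (bilat N L)
    ((\<Sum>n\<le>N. fps_X ^ n * oddp n) + (\<Sum>n\<le>N. (\<Prod>j<n. fps_X ^ (2 * j + 2)) * inverse (oddp (Suc n))))"
  unfolding bilat_def
proof (intro ceq_add ceq_sum)
  fix n
  have "ceq N (stepp L (Suc n)) (\<Prod>j<Suc n. 1)"
    unfolding stepp_def by (intro ceq_prod ceq_one_diff) (use assms in auto)
  then have "ceq N (inverse (stepp L (Suc n))) 1"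
    using assms by (intro ceq_inverse_1) auto
  from ceq_multl[OF this, of "fps_X ^ n * oddp n"]
  show "ceq N (posterm L n) (fps_X ^ n * oddp n)" by (simp add: posterm_def)
  show "ceq N (negterm L n) ((\<Prod>j<n. fps_X ^ (2 * j + 2)) * inverse (oddp (Suc n)))"
    unfolding negterm_def by (intro ceq_mult ceq_refl ceq_prod) (use assms in \<open>auto simp: ceq_nth\<close>)
qed

section \<open>The q-binomial series that evaluates the even chain\<close>

definition hterm :: "nat \<Rightarrow> nat \<Rightarrow> rat fps" where
  "hterm j n = fps_X ^ (j * n) * oddp n * inverse (stepp 2 n)"

lemma inverse_stepp_Suc:
  "L > 0 \<Longrightarrow> inverse (stepp L (Suc n)) * (1 - fps_X ^ (L + 2 * n)) = inverse (stepp L n)"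
  by (rule mult_inverse_cancel) (simp_all add: stepp_Suc)

lemma hterm_Suc:
  "(1 - fps_X ^ (2 * Suc n)) * hterm j (Suc n) = fps_X ^ j * (1 + fps_X ^ (2 * n + 1)) * hterm j n"
  unfolding hterm_def oddp_Suc using inverse_stepp_Suc[of 2 n]
  by (simp add: power_add mult_ac)

text \<open>The functional equation behind the q-binomial theorem: the sum over n is
  (-q^(j+1);q^2)_\<infinity> / (q^j;q^2)_\<infinity>. It telescopes because \<open>hterm_Suc\<close>
  expresses q^j (1 + q^(2n+1)) times a summand through the next summand.\<close>

lemma hterm_contiguous:
  assumes "j > 0"
  shows "ceq N ((1 - fps_X ^ j) * (\<Sum>n\<le>N. hterm j n)) ((1 + fps_X ^ (j + 1)) * (\<Sum>n\<le>N. hterm (j + 2) n))"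
proof -
  have step: "(1 - fps_X ^ j) * hterm j n - (1 + fps_X ^ (j + 1)) * hterm (j + 2) n
      = (1 - fps_X ^ (2 * n)) * hterm j n - (1 - fps_X ^ (2 * Suc n)) * hterm j (Suc n)" for n
    unfolding hterm_Suc by (simp add: hterm_def algebra_simps power_add mult_2_right)
  have "(1 - fps_X ^ j) * (\<Sum>n\<le>N. hterm j n) - (1 + fps_X ^ (j + 1)) * (\<Sum>n\<le>N. hterm (j + 2) n)
      = (\<Sum>n\<le>N. (1 - fps_X ^ j) * hterm j n - (1 + fps_X ^ (j + 1)) * hterm (j + 2) n)"
    by (simp add: sum_subtractf flip: sum_distrib_left)
  also have "\<dots> = - ((1 - fps_X ^ (2 * Suc N)) * hterm j (Suc N))"
    unfolding step by (induction N) auto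
  also have "fps_X ^ N dvd \<dots>"
  proof -
    have "N \<le> j * Suc N" using assms by (cases j) auto
    then have "fps_X ^ N dvd hterm j (Suc N)"
      unfolding hterm_def by (intro dvd_mult2 le_imp_power_dvd)
    then show ?thesis by simp
  qed
  finally show ?thesis by (simp add: ceq_def)
qed

text \<open>At L = 2 the factor j = 0 of \<open>negterm\<close> is X^2 - X^2, so only index -1
  survives among the negative ones.\<close>

lemma bilat_2: "ceq N ((1 + fps_X) * bilat N 2) (2 * (\<Sum>n\<le>N. hterm 1 n))"
proof -
  have neg: "(\<Sum>n\<le>N. negterm 2 n) = inverse (1 + fps_X)"
  proof -
    have "negterm 2 n = 0" if "n > 0" for n
      using that by (auto simp: negterm_def power2_eq_square intro!: prod_zero bexI[of _ 0])
    then have "(\<Sum>n\<le>N. negterm 2 n) = (\<Sum>n\<in>{0}. negterm 2 n)"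
      by (intro sum.mono_neutral_right) auto
    then show ?thesis by (simp add: negterm_0)
  qed
  have i1: "(1 + fps_X) * inverse (1 + fps_X) = (1 :: rat fps)"
    by (rule inverse_mult_eq_1') simp
  have step: "(1 + fps_X) * posterm 2 n - 2 * hterm 1 n = hterm 1 (Suc n) - hterm 1 n" for n
  proof -
    have 1: "hterm 1 n = (1 - fps_X ^ (2 + 2 * n)) * posterm 2 n"
      using inverse_stepp_Suc[of 2 n] by (simp add: posterm_def hterm_def mult_ac)
    have 2: "hterm 1 (Suc n) = fps_X * (1 + fps_X ^ (2 * n + 1)) * posterm 2 n"
      by (simp add: posterm_def hterm_def oddp_Suc mult_ac)
    show ?thesis unfolding 1 2 by (simp add: algebra_simps)
  qed
  have "(1 + fps_X) * bilat N 2 - 2 * (\<Sum>n\<le>N. hterm 1 n)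
      = (\<Sum>n\<le>N. (1 + fps_X) * posterm 2 n - 2 * hterm 1 n) + 1"
    unfolding bilat_def neg distrib_left i1 by (simp add: sum_subtractf flip: sum_distrib_left)
  \<comment> \<open>The 1 contributed by index -1 cancels the lower end \<open>hterm 1 0\<close> of
    the telescoping sum.\<close>
  also have "\<dots> = hterm 1 (Suc N)"
  proof -
    have "(\<Sum>n\<le>N. hterm 1 (Suc n) - hterm 1 n) = hterm 1 (Suc N) - hterm 1 0"
      by (induction N) auto
    then show ?thesis unfolding step by (simp add: hterm_def)
  qed
  also have "fps_X ^ N dvd \<dots>"
    by (auto simp: hterm_def intro!: dvd_mult2 le_imp_power_dvd)
  finally show ?thesis by (simp add: ceq_def)
qed

text \<open>\<open>g1\<close> runs from L = 1 and \<open>g2\<close> from L = 2 up to the common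
  limit \<open>?G\<close>; \<open>bilat_2\<close> and \<open>h\<close> evaluate the start of the
  even chain, hence \<open>?G\<close>.\<close>

lemma bilat_1_product:
  "ceq N (bilat N 1 * (\<Prod>k<N. 1 - fps_X ^ (4 * k + 2)) ^ 2)
     (2 * (\<Prod>k<N. 1 + fps_X ^ (2 * k + 2)) ^ 2 * (\<Prod>k<N. 1 - fps_X ^ (4 * k + 4)))"
proof -
  let ?a = "\<Prod>k<N. 1 - fps_X ^ (4 * k + 2) :: rat fps"
  let ?e = "\<Prod>k<N. 1 + fps_X ^ (2 * k + 2) :: rat fps"
  let ?d = "\<Prod>k<N. 1 - fps_X ^ (4 * k + 4) :: rat fps"
  let ?o' = "\<Prod>k<N. 1 + fps_X ^ (2 * k + 3) :: rat fps"
  let ?w = "\<Prod>k<N. 1 - fps_X ^ (2 * k + 1) :: rat fps"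
  let ?H = "\<Sum>n\<le>N. hterm 1 n"
  have g1: "ceq N (?a * bilat N 1) (?e * bilat N (2 * N + 1))"
    using ceq_iterate[of N "\<lambda>k. 1 - fps_X ^ (4 * k + 2)" "\<lambda>k. bilat N (2 * k + 1)"
        "\<lambda>k. 1 + fps_X ^ (2 * k + 2)" N]
      bilat_contiguous[of "2 * k + 1" N for k] by (simp add: algebra_simps)
  have g2: "ceq N (?d * bilat N 2) (?o' * bilat N (2 * N + 2))"
    using ceq_iterate[of N "\<lambda>k. 1 - fps_X ^ (4 * k + 4)" "\<lambda>k. bilat N (2 * k + 2)"
        "\<lambda>k. 1 + fps_X ^ (2 * k + 3)" N]
      bilat_contiguous[of "2 * k + 2" N for k] by (simp add: algebra_simps eval_nat_numeral)
  have g3: "ceq N (bilat N (2 * N + 2)) (bilat N (2 * N + 1))"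
    by (rule ceq_trans[OF bilat_stable ceq_sym[OF bilat_stable]]) auto
  have h1: "ceq N (?w * ?H) (?e * (\<Sum>n\<le>N. hterm (2 * N + 1) n))"
    using ceq_iterate[of N "\<lambda>k. 1 - fps_X ^ (2 * k + 1)" "\<lambda>k. \<Sum>n\<le>N. hterm (2 * k + 1) n"
        "\<lambda>k. 1 + fps_X ^ (2 * k + 2)" N]
      hterm_contiguous[of "2 * k + 1" N for k] by (simp add: algebra_simps)
  have h2: "ceq N (\<Sum>n\<le>N. hterm (2 * N + 1) n) 1"
  proof -
    have "ceq N (hterm (2 * N + 1) n) (if n = 0 then 1 else 0)" for n
    proof (cases n)
      case (Suc m)
      have "fps_X ^ N dvd hterm (2 * N + 1) n"
        unfolding hterm_def Suc by (intro dvd_mult2 le_imp_power_dvd) auto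
      then show ?thesis by (simp add: Suc ceq_def)
    qed (simp add: hterm_def)
    then have "ceq N (\<Sum>n\<le>N. hterm (2 * N + 1) n) (\<Sum>n\<le>N. if n = 0 then 1 else 0)"
      by (intro ceq_sum)
    then show ?thesis by simp
  qed
  have h: "ceq N (?w * ?H) ?e"
    using ceq_trans[OF h1 ceq_multl[OF h2, of ?e]] by simp
  \<comment> \<open>The factor 1 + X left by \<open>bilat_2\<close> is the missing first factor of
    \<open>?o'\<close>; the surplus last factor is 1 modulo X^N.\<close>
  have o: "ceq N ((1 + fps_X) * ?o') (\<Prod>k<N. 1 + fps_X ^ (2 * k + 1))"
  proof -
    have "2 * Suc k + 1 = 2 * k + 3" for k by simp
    then have "(1 + fps_X) * ?o' = (\<Prod>k<Suc N. 1 + fps_X ^ (2 * k + 1))"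
      by (subst prod.lessThan_Suc_shift) (simp only: mult_0_right add_0 power_one_right)
    also have "\<dots> = (\<Prod>k<N. 1 + fps_X ^ (2 * k + 1)) * (1 + fps_X ^ (2 * N + 1))"
      by simp
    also have "ceq N \<dots> ((\<Prod>k<N. 1 + fps_X ^ (2 * k + 1)) * 1)"
      by (intro ceq_multl ceq_one_add) simp
    finally show ?thesis by simp
  qed
  have ow: "(\<Prod>k<N. 1 + fps_X ^ (2 * k + 1)) * ?w = ?a"
    by (simp add: algebra_simps flip: prod.distrib power_add)
  let ?G = "bilat N (2 * N + 1)"
  have "ceq N (?a * ?G) (((1 + fps_X) * ?o') * ?w * ?G)"
    unfolding ow[symmetric] by (intro ceq_mult ceq_sym[OF o] ceq_refl)
  also have "((1 + fps_X) * ?o') * ?w * ?G = ?w * (1 + fps_X) * (?o' * ?G)" by (simp add: mult_ac)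
  also have "ceq N \<dots> (?w * (1 + fps_X) * (?d * bilat N 2))"
    by (intro ceq_multl ceq_trans[OF ceq_multl[OF ceq_sym[OF g3]] ceq_sym[OF g2]])
  also have "?w * (1 + fps_X) * (?d * bilat N 2) = ?w * ?d * ((1 + fps_X) * bilat N 2)"
    by (simp add: mult_ac)
  also have "ceq N \<dots> (?w * ?d * (2 * ?H))"
    by (intro ceq_multl bilat_2)
  also have "?w * ?d * (2 * ?H) = 2 * ?d * (?w * ?H)" by (simp add: mult_ac)
  also have "ceq N \<dots> (2 * ?d * ?e)" by (intro ceq_multl h)
  finally have G: "ceq N (?a * ?G) (2 * ?d * ?e)" .
  have "bilat N 1 * ?a ^ 2 = ?a * (?a * bilat N 1)" by (simp add: power2_eq_square mult_ac)
  also have "ceq N \<dots> (?a * (?e * ?G))" by (intro ceq_multl g1)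
  also have "?a * (?e * ?G) = ?e * (?a * ?G)" by (simp add: mult_ac)
  also have "ceq N \<dots> (?e * (2 * ?d * ?e))" by (intro ceq_multl G)
  finally show ?thesis by (simp add: power2_eq_square mult_ac)
qed

section \<open>The bilateral series at L = 1 as B(q) + B(-q)\<close>

lemma posterm_1: "posterm 1 n = Bterm n"
  by (simp add: posterm_def Bterm_def qpoch_def oddp_def stepp_def power_mult)

text \<open>The substitution q -> -q exchanges (q;q^2) and (-q;q^2), and the factors X^(2j+2) - X =
  -X (1 - X^(2j+1)) supply (-q)^n.\<close>

lemma negterm_1: "negterm 1 n = Bterm n oo (- fps_X)"
proof -
  have 1: "(1 - fps_X * (fps_X ^ 2) ^ j) oo (- fps_X) = (1 + fps_X ^ (2 * j + 1) :: rat fps)" for j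
    by (simp add: fps_compose_sub_distrib fps_compose_mult_distrib power_mult_distrib
        flip: power_mult fps_compose_power)
  have 2: "(1 - - fps_X * (fps_X ^ 2) ^ j) oo (- fps_X) = (1 - fps_X ^ (2 * j + 1) :: rat fps)" for j
    by (simp add: fps_compose_sub_distrib fps_compose_add_distrib fps_compose_mult_distrib power_mult_distrib
        flip: power_mult fps_compose_power)
  have 3: "(\<Prod>j<n. fps_X ^ (2 * j + 2) - fps_X ^ 1)
      = (- fps_X) ^ n * (\<Prod>j<n. 1 - fps_X ^ (2 * j + 1) :: rat fps)"
    by (induction n) (simp_all add: algebra_simps)
  have 4: "fps_X ^ n oo (- fps_X) = (- fps_X :: rat fps) ^ n"
    by (simp flip: fps_compose_power)
  have q0: "qpoch fps_X (fps_X ^ 2) (Suc n) $ 0 \<noteq> (0 :: rat)"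
    by (simp add: qpoch_def fps_prod_nth_0)
  have "Bterm n oo (- fps_X) = (- fps_X) ^ n
      * (qpoch (- fps_X) (fps_X ^ 2) n oo (- fps_X)) * inverse (qpoch fps_X (fps_X ^ 2) (Suc n) oo (- fps_X))"
    unfolding Bterm_def by (simp add: fps_compose_mult_distrib 4 fps_inverse_compose q0)
  also have "\<dots> = negterm 1 n"
  proof -
    have "qpoch (- fps_X) (fps_X ^ 2) n oo (- fps_X) = (\<Prod>j<n. 1 - fps_X ^ (2 * j + 1) :: rat fps)"
      unfolding qpoch_def by (subst fps_compose_prod_distrib) (simp_all only: 2, simp)
    moreover have "qpoch fps_X (fps_X ^ 2) (Suc n) oo (- fps_X) = oddp (Suc n)"
      unfolding qpoch_def oddp_def by (subst fps_compose_prod_distrib) (simp_all only: 1, simp)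
    ultimately show ?thesis unfolding negterm_def 3 by simp
  qed
  finally show ?thesis by simp
qed

lemma bilat_1_nth:
  assumes "i \<le> N" shows "bilat N 1 $ i = (1 + (- 1) ^ i) * b i"
proof -
  have z: "Bterm n $ i = 0" if "n > i" for n
    using that by (simp add: Bterm_def fps_X_power_mult_nth mult.assoc)
  have s: "(\<Sum>n\<le>N. Bterm n $ i) = b i"
    unfolding b_def mockB_def fps_nth_Abs_fps fps_sum_nth
    by (rule sum.mono_neutral_right) (use assms z in auto)
  have "(\<Sum>n\<le>N. (Bterm n oo (- fps_X)) $ i) = (- 1) ^ i * (\<Sum>n\<le>N. Bterm n $ i)"
    by (simp add: sum_distrib_left fps_compose_uminus')
  then show ?thesis
    unfolding bilat_def posterm_1 negterm_1 by (simp add: fps_sum_nth s algebra_simps)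
qed

section \<open>Theta series\<close>

text \<open>Formally the sum of w(x) q^(f x) over A. With an arbitrary index set, theta identities
  reduce to bijections of lattices. A sum over an infinite fibre would be 0 by convention, hence the
  condition \<open>finite_fibres\<close> in the laws for products and unions.\<close>

definition ser :: "'x set \<Rightarrow> ('x \<Rightarrow> nat) \<Rightarrow> ('x \<Rightarrow> rat) \<Rightarrow> rat fps" where
  "ser A f w = Abs_fps (\<lambda>n. \<Sum>x\<in>{x \<in> A. f x = n}. w x)"

definition finite_fibres :: "'x set \<Rightarrow> ('x \<Rightarrow> nat) \<Rightarrow> bool" where
  "finite_fibres A f \<longleftrightarrow> (\<forall>n. finite {x \<in> A. f x = n})"

lemma ser_nth: "ser A f w $ n = (\<Sum>x\<in>{x \<in> A. f x = n}. w x)"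
  by (simp add: ser_def)

lemma finite_fibres_subset: "finite_fibres B f \<Longrightarrow> A \<subseteq> B \<Longrightarrow> finite_fibres A f"
  unfolding finite_fibres_def by (auto intro: finite_subset[of "{x \<in> A. f x = _}" "{x \<in> B. f x = _}"])

lemma finite_fibres_Times:
  assumes "finite_fibres A f" "finite_fibres B g"
  shows "finite_fibres (A \<times> B) (\<lambda>(x, y). f x + g y)"
  unfolding finite_fibres_def
proof
  fix n
  have "{z \<in> A \<times> B. (case z of (x, y) \<Rightarrow> f x + g y) = n}
      \<subseteq> (\<Union>i\<le>n. {x \<in> A. f x = i} \<times> {y \<in> B. g y = n - i})"
    by auto
  moreover have "finite \<dots>" using assms by (auto simp: finite_fibres_def)
  ultimately show "finite {z \<in> A \<times> B. (case z of (x, y) \<Rightarrow> f x + g y) = n}"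
    by (rule finite_subset)
qed

lemma finite_fibres_reindex:
  assumes "bij_betw h A B" "finite_fibres B f" "\<And>x. x \<in> A \<Longrightarrow> f (h x) = f' x"
  shows "finite_fibres A f'"
  unfolding finite_fibres_def
proof
  fix n
  have "h ` {x \<in> A. f' x = n} \<subseteq> {x \<in> B. f x = n}" "inj_on h {x \<in> A. f' x = n}"
    using assms(1,3) by (auto simp: bij_betw_def inj_on_def)
  then show "finite {x \<in> A. f' x = n}"
    using assms(2) unfolding finite_fibres_def by (meson finite_imageD finite_subset)
qed

lemma ser_mult:
  assumes "finite_fibres A f" "finite_fibres B g"
  shows "ser A f w * ser B g v = ser (A \<times> B) (\<lambda>(x, y). f x + g y) (\<lambda>(x, y). w x * v y)"
proof (rule fps_ext)
  fix n
  let ?F = "\<lambda>i. {x \<in> A. f x = i} \<times> {y \<in> B. g y = n - i}"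
  have "(ser A f w * ser B g v) $ n = (\<Sum>i=0..n. \<Sum>(x, y)\<in>?F i. w x * v y)"
    by (simp add: fps_mult_nth ser_nth sum_product sum.cartesian_product)
  also have "\<dots> = (\<Sum>(x, y)\<in>(\<Union>i\<in>{0..n}. ?F i). w x * v y)"
    by (rule sum.UNION_disjoint[symmetric]) (use assms in \<open>auto simp: finite_fibres_def\<close>)
  also have "(\<Union>i\<in>{0..n}. ?F i) = {z \<in> A \<times> B. (case z of (x, y) \<Rightarrow> f x + g y) = n}"
    by auto
  finally show "(ser A f w * ser B g v) $ n
      = ser (A \<times> B) (\<lambda>(x, y). f x + g y) (\<lambda>(x, y). w x * v y) $ n"
    by (simp add: ser_nth)
qed

lemma ser_reindex:
  assumes "bij_betw h A B" "\<And>x. x \<in> A \<Longrightarrow> f (h x) = f' x" "\<And>x. x \<in> A \<Longrightarrow> w (h x) = w' x"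
  shows "ser B f w = ser A f' w'"
proof (rule fps_ext)
  fix n
  have "bij_betw h {x \<in> A. f' x = n} {x \<in> B. f x = n}"
    using assms(1,2) by (auto simp: bij_betw_def inj_on_def)
  then have "(\<Sum>x\<in>{x \<in> B. f x = n}. w x) = (\<Sum>x\<in>{x \<in> A. f' x = n}. w (h x))"
    by (rule sum.reindex_bij_betw[symmetric])
  then show "ser B f w $ n = ser A f' w' $ n" using assms(3) by (simp add: ser_nth)
qed

lemma ser_Un:
  assumes "finite_fibres A f" "finite_fibres B f" "A \<inter> B = {}"
  shows "ser (A \<union> B) f w = ser A f w + ser B f w"
proof (rule fps_ext)
  fix n
  have "{x \<in> A \<union> B. f x = n} = {x \<in> A. f x = n} \<union> {x \<in> B. f x = n}" by auto
  then show "ser (A \<union> B) f w $ n = (ser A f w + ser B f w) $ n"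
    using assms by (simp add: ser_nth finite_fibres_def) (intro sum.union_disjoint; auto)
qed

lemma ser_uminus: "ser A f (\<lambda>x. - w x) = - ser A f w"
  by (rule fps_ext) (simp add: ser_nth sum_negf)

lemma ceq_ser:
  assumes "finite F" "F \<subseteq> A" "\<And>x. x \<in> A - F \<Longrightarrow> N \<le> f x"
  shows "ceq N (ser A f w) (\<Sum>x\<in>F. fps_const (w x) * fps_X ^ f x)"
  unfolding ceq_nth
proof (intro allI impI)
  fix i assume i: "i < N"
  have "(\<Sum>x\<in>F. fps_const (w x) * fps_X ^ f x) $ i = (\<Sum>x\<in>F. if f x = i then w x else 0)"
    by (auto simp: fps_sum_nth intro!: sum.cong)
  also have "\<dots> = (\<Sum>x\<in>{x \<in> F. f x = i}. w x)"
    using assms(1) by (simp add: sum.inter_filter)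
  also have "{x \<in> F. f x = i} = {x \<in> A. f x = i}"
    using assms i by fastforce
  finally show "ser A f w $ i = (\<Sum>x\<in>F. fps_const (w x) * fps_X ^ f x) $ i"
    by (simp add: ser_nth)
qed

text \<open>Shanks' finite forms of Gauss' product formulas for the two theta series.\<close>

lemma shanks_triangular:
  fixes q :: "'a::idom" and P R :: "nat \<Rightarrow> 'a"
  assumes P: "P 0 = 1" "\<And>n. P (Suc n) * (1 - q ^ (2 * n + 1)) = P n * (1 - q ^ (2 * n + 2))"
    and R: "\<And>n. R (Suc n) * (1 - q ^ (2 * n + 2)) = R n * (1 - q ^ (2 * n + 1))"
    and PR: "\<And>n. P n * R n = 1"
    and q: "\<And>n. q ^ Suc n \<noteq> 1"
  shows "P n * (\<Sum>s<n. q ^ (s * (2 * n + 1)) * R s) = (\<Sum>k<2 * n. q ^ (k * (k + 1) div 2))"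
proof (induction n)
  case (Suc n)
  define x where "x s = q ^ (s * (2 * n + 1)) * R s" for s
  define c where "c = q ^ (2 * n + 1)"
  have xs: "x (Suc m) * (1 - q ^ (2 * m + 2)) = c * (1 - q ^ (2 * m + 1)) * x m" for m
    using R[of m] by (simp add: x_def c_def power_add mult_ac)
  \<comment> \<open>Passing from n to n + 1 multiplies summand s by q^(2s), and P (n + 1) / P n = (1
    - c q) / (1 - c). Weighted by these factors, the new and old sums differ by a telescoping sum,
    by the recurrence for \<open>R\<close>.\<close>
  have tel: "(1 - c * q) * (\<Sum>s<m. q ^ (2 * s) * x s) - (1 - c) * (\<Sum>s<m. x s) = x m * (1 - q ^ (2 * m))" for m
  proof (induction m)
    case (Suc m)
    have e: "q ^ (2 * Suc m) = q ^ (2 * m + 2)" "q ^ (2 * m + 1) = q ^ (2 * m) * q" by simp_all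
    show ?case unfolding e(1) xs using Suc unfolding e(2) by (simp add: algebra_simps)
  qed simp
  have s: "(\<Sum>s<Suc n. q ^ (s * (2 * Suc n + 1)) * R s) = (\<Sum>s<Suc n. q ^ (2 * s) * x s)"
  proof -
    have "q ^ (s * (2 * Suc n + 1)) = q ^ (2 * s) * q ^ (s * (2 * n + 1))" for s
      by (simp add: algebra_simps flip: power_add)
    then show ?thesis by (simp add: x_def mult.assoc)
  qed
  have Px: "P n * x n = q ^ (n * (2 * n + 1))"
    using PR[of n] by (simp add: x_def mult.left_commute)
  have cc: "1 - c \<noteq> 0" using q[of "2 * n"] by (simp add: c_def)
  let ?T = "\<Sum>s<n. x s" and ?U = "\<Sum>s<n. q ^ (2 * s) * x s"
  have P1: "P (Suc n) * (1 - c) = P n * (1 - c * q)"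
    using P(2)[of n] by (simp add: c_def mult.commute)
  have c2: "c ^ 2 = q ^ (2 * n) * q ^ (2 * n) * q ^ 2"
    by (simp add: c_def power2_eq_square power_add[symmetric])
  have c1: "c = q ^ (2 * n) * q" by (simp add: c_def)
  have "(1 - c) * (P (Suc n) * (\<Sum>s<Suc n. q ^ (2 * s) * x s)) - (1 - c) * (P n * ?T)
      = (P (Suc n) * (1 - c)) * (?U + q ^ (2 * n) * x n) - (1 - c) * (P n * ?T)"
    by (simp add: mult_ac)
  also have "\<dots> = P n * (((1 - c * q) * ?U - (1 - c) * ?T) + (1 - c * q) * (q ^ (2 * n) * x n))"
    unfolding P1 by (simp add: algebra_simps)
  also have "\<dots> = (P n * x n) * (1 - c * q * q ^ (2 * n))"
    unfolding tel by (simp add: algebra_simps)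
  also have "\<dots> = (1 - c) * (q ^ (n * (2 * n + 1)) * (1 + c))"
    unfolding Px by (simp add: algebra_simps c1)
  finally have "(1 - c) * (P (Suc n) * (\<Sum>s<Suc n. q ^ (2 * s) * x s))
      = (1 - c) * (P n * ?T + q ^ (n * (2 * n + 1)) * (1 + c))"
    by (simp add: algebra_simps)
  then have PS: "P (Suc n) * (\<Sum>s<Suc n. q ^ (2 * s) * x s) = P n * ?T + q ^ (n * (2 * n + 1)) * (1 + c)"
    using cc mult_left_cancel by blast
  have "2 * n * (2 * n + 1) div 2 = n * (2 * n + 1)"
    "(2 * n + 1) * (2 * n + 1 + 1) div 2 = n * (2 * n + 1) + (2 * n + 1)"
    by (simp_all add: algebra_simps)
  note T = this
  have "(\<Sum>k<2 * Suc n. q ^ (k * (k + 1) div 2)) = (\<Sum>k<2 * n. q ^ (k * (k + 1) div 2))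
      + q ^ (2 * n * (2 * n + 1) div 2) + q ^ ((2 * n + 1) * (2 * n + 1 + 1) div 2)"
    by simp
  also have "\<dots> = (\<Sum>k<2 * n. q ^ (k * (k + 1) div 2)) + q ^ (n * (2 * n + 1)) * (1 + c)"
  proof -
    have "q ^ (n * (2 * n + 1) + (2 * n + 1)) = q ^ (n * (2 * n + 1)) * c"
      unfolding c_def by (rule power_add)
    then show ?thesis unfolding T by (simp add: distrib_left)
  qed
  finally have "(\<Sum>k<2 * Suc n. q ^ (k * (k + 1) div 2))
      = (\<Sum>k<2 * n. q ^ (k * (k + 1) div 2)) + q ^ (n * (2 * n + 1)) * (1 + c)" .
  with PS show ?case using Suc unfolding s x_def by simp
qed simp

text \<open>The right-hand side is the mean of the partial sums of the theta series up to n and up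
  to n + 1, which is why the last square has weight one instead of two.\<close>

lemma shanks_square:
  fixes q :: "'a::idom" and P R :: "nat \<Rightarrow> 'a"
  assumes P: "P 0 = 1" "\<And>n. P (Suc n) * (1 + q ^ Suc n) = P n * (1 - q ^ Suc n)"
    and R: "\<And>n. R (Suc n) * (1 - q ^ Suc n) = R n * (1 + q ^ Suc n)"
    and PR: "\<And>n. P n * R n = 1"
    and q: "\<And>n. q ^ Suc n \<noteq> - 1"
  shows "(1 - q ^ Suc n) * (P n * (\<Sum>s\<le>n. (- 1) ^ s * q ^ (s * Suc n) * R s))
    = 1 + 2 * (\<Sum>s=1..n. (- 1) ^ s * q ^ s\<^sup>2) + (- 1) ^ Suc n * q ^ (Suc n)\<^sup>2"
proof (induction n)
  case 0
  show ?case using P(1) PR[of 0] by simp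
next
  case (Suc n)
  define x where "x s = (- 1) ^ s * q ^ (s * Suc n) * R s" for s
  define c where "c = q ^ Suc n"
  have xs: "x (Suc m) * (1 - q ^ Suc m) = - c * (1 + q ^ Suc m) * x m" for m
    using R[of m] by (simp add: x_def c_def power_add mult_ac)
  have tel: "(1 - c * q) * (\<Sum>s<m. q ^ s * x s) - (1 + c) * (\<Sum>s<m. x s) = x m * (1 - q ^ m)" for m
  proof (induction m)
    case (Suc m)
    have e: "(1 - c * q) * (\<Sum>s<Suc m. q ^ s * x s) - (1 + c) * (\<Sum>s<Suc m. x s)
        = ((1 - c * q) * (\<Sum>s<m. q ^ s * x s) - (1 + c) * (\<Sum>s<m. x s))
          + ((1 - c * q) * (q ^ m * x m) - (1 + c) * x m)"
      by (simp add: algebra_simps)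
    show ?case unfolding e xs Suc by (simp add: algebra_simps)
  qed simp
  have s: "(\<Sum>s\<le>Suc n. (- 1) ^ s * q ^ (s * Suc (Suc n)) * R s) = (\<Sum>s<Suc n. q ^ s * x s) + c * x (Suc n)"
  proof -
    have "(- 1) ^ s * q ^ (s * Suc (Suc n)) * R s = q ^ s * x s" for s
      by (simp add: x_def power_add mult_ac)
    then show ?thesis by (simp add: lessThan_Suc_atMost c_def)
  qed
  have cc: "1 + c \<noteq> 0" using q[of n] by (simp add: c_def add_eq_0_iff)
  let ?T = "\<Sum>s<Suc n. x s" and ?U = "\<Sum>s<Suc n. q ^ s * x s"
  have P1: "P (Suc n) * (1 + c) = P n * (1 - c)"
    using P(2)[of n] by (simp add: c_def)
  have Px: "P (Suc n) * x (Suc n) = (- 1) ^ Suc n * q ^ (Suc n)\<^sup>2"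
    using PR[of "Suc n"] by (simp add: x_def mult_ac power2_eq_square)
  have "(1 + c) * ((1 - c * q) * (P (Suc n) * (?U + c * x (Suc n)))) - (1 + c) * ((1 - c) * (P n * ?T))
      = (P (Suc n) * (1 + c)) * (1 - c * q) * (?U + c * x (Suc n)) - (1 + c) * ((1 - c) * (P n * ?T))"
    by (simp only: mult_ac)
  also have "\<dots> = P n * (1 - c) * (((1 - c * q) * ?U - (1 + c) * ?T) + (1 - c * q) * (c * x (Suc n)))"
    unfolding P1 by (simp add: algebra_simps)
  also have "(1 - c * q) * ?U - (1 + c) * ?T = x (Suc n) * (1 - c)"
    using tel[of "Suc n"] unfolding c_def .
  also have "P n * (1 - c) * (x (Suc n) * (1 - c) + (1 - c * q) * (c * x (Suc n)))
      = P n * (1 - c) * (x (Suc n) * (1 - c ^ 2 * q))"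
    by (simp add: algebra_simps power2_eq_square)
  also have "\<dots> = (1 + c) * ((P (Suc n) * x (Suc n)) * (1 - c ^ 2 * q))"
    unfolding P1[symmetric] by (simp only: mult_ac)
  finally have "(1 + c) * ((1 - c * q) * (P (Suc n) * (?U + c * x (Suc n))))
      = (1 + c) * ((1 - c) * (P n * ?T) + (P (Suc n) * x (Suc n)) * (1 - c ^ 2 * q))"
    by (simp add: algebra_simps)
  then have "(1 - c * q) * (P (Suc n) * (?U + c * x (Suc n)))
      = (1 - c) * (P n * ?T) + (- 1) ^ Suc n * q ^ (Suc n)\<^sup>2 * (1 - c ^ 2 * q)"
    unfolding Px using cc mult_left_cancel by blast
  moreover have "q ^ (Suc n)\<^sup>2 * (c ^ 2 * q) = q ^ (Suc (Suc n))\<^sup>2"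
  proof -
    have e: "(Suc (Suc n))\<^sup>2 = (Suc n)\<^sup>2 + (Suc n * 2 + 1)"
      by (simp add: power2_eq_square)
    show ?thesis unfolding e power_add power_mult c_def by simp
  qed
  then have "q ^ (Suc n)\<^sup>2 * (1 - c ^ 2 * q) = q ^ (Suc n)\<^sup>2 - q ^ (Suc (Suc n))\<^sup>2"
    by (simp add: algebra_simps)
  ultimately have F1: "(1 - c * q) * (P (Suc n) * (?U + c * x (Suc n)))
      = (1 - c) * (P n * ?T) + (- 1) ^ Suc n * (q ^ (Suc n)\<^sup>2 - q ^ (Suc (Suc n))\<^sup>2)"
    by (simp add: mult.assoc)
  have F2: "(1 - c) * (P n * ?T)
      = 1 + 2 * (\<Sum>s=1..n. (- 1) ^ s * q ^ s\<^sup>2) + (- 1) ^ Suc n * q ^ (Suc n)\<^sup>2"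
    using Suc unfolding x_def c_def lessThan_Suc_atMost .
  have F3: "q ^ Suc (Suc n) = c * q" by (simp add: c_def)
  have F4: "(\<Sum>s=1..Suc n. (- 1) ^ s * q ^ s\<^sup>2) = (\<Sum>s=1..n. (- 1) ^ s * q ^ s\<^sup>2) + (- 1) ^ Suc n * q ^ (Suc n)\<^sup>2"
    by simp
  show ?case unfolding s F3 F1 F2 F4 by (simp add: algebra_simps)
qed

section \<open>Gauss' product formulas for psi(q) and phi(-q)\<close>

definition psi :: "rat fps" where
  "psi = ser (UNIV :: nat set) (\<lambda>k. k * (k + 1) div 2) (\<lambda>_. 1)"

definition sg :: "int \<Rightarrow> rat" where
  "sg x = (if even x then 1 else - 1)"

definition phim :: "rat fps" where
  "phim = ser UNIV (\<lambda>x. nat (x\<^sup>2)) sg"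

lemma X_power_Suc_neq: "(fps_X ^ Suc n :: rat fps) \<noteq> 1" "(fps_X ^ Suc n :: rat fps) \<noteq> - 1"
proof -
  have "(fps_X ^ Suc n :: rat fps) $ 0 \<noteq> 1 $ 0" "(fps_X ^ Suc n :: rat fps) $ 0 \<noteq> (- 1) $ 0" by simp_all
  then show "(fps_X ^ Suc n :: rat fps) \<noteq> 1" "(fps_X ^ Suc n :: rat fps) \<noteq> - 1" by metis+
qed

text \<open>In Shanks' sum every s > 0 carries a power q^(2N+1), so modulo X^N only s = 0 remains
  and the left side becomes \<open>P N\<close>. For N = 0 the sum lacks even this term, hence the
  case split.\<close>

lemma psi_product:
  "ceq N (psi * (\<Prod>k<N. 1 - fps_X ^ (2 * k + 1))) (\<Prod>k<N. 1 - fps_X ^ (2 * k + 2))"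
proof (cases "N = 0")
  case False
  define A B :: "nat \<Rightarrow> rat fps" where "A n = (\<Prod>k<n. 1 - fps_X ^ (2 * k + 1))"
    and "B n = (\<Prod>k<n. 1 - fps_X ^ (2 * k + 2))" for n
  have 0: "A n $ 0 = 1" "B n $ 0 = 1" for n by (simp_all add: A_def B_def fps_prod_nth_0)
  have i: "A n * inverse (A n) = 1" "B n * inverse (B n) = 1" for n
    by (rule inverse_mult_eq_1', simp add: 0)+
  have S: "A (Suc n) = A n * (1 - fps_X ^ (2 * n + 1))" "B (Suc n) = B n * (1 - fps_X ^ (2 * n + 2))" for n
    by (simp_all add: A_def B_def)
  define P R where "P n = B n * inverse (A n)" and "R n = A n * inverse (B n)" for n
  have iS: "inverse (A (Suc n)) * (1 - fps_X ^ (2 * n + 1)) = inverse (A n)"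
    "inverse (B (Suc n)) * (1 - fps_X ^ (2 * n + 2)) = inverse (B n)" for n
    by (rule mult_inverse_cancel; simp add: S 0)+
  have "P n * (\<Sum>s<n. fps_X ^ (s * (2 * n + 1)) * R s) = (\<Sum>k<2 * n. fps_X ^ (k * (k + 1) div 2))" for n
  proof (rule shanks_triangular)
    show "P 0 = 1" by (simp add: P_def A_def B_def)
    show "P (Suc n) * (1 - fps_X ^ (2 * n + 1)) = P n * (1 - fps_X ^ (2 * n + 2))" for n
      unfolding P_def iS(1)[of n, symmetric] S(2) by (simp only: mult_ac)
    show "R (Suc n) * (1 - fps_X ^ (2 * n + 2)) = R n * (1 - fps_X ^ (2 * n + 1))" for n
      unfolding R_def iS(2)[of n, symmetric] S(1) by (simp only: mult_ac)
    show "P n * R n = 1" for n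
      unfolding P_def R_def using i[of n] by (metis (no_types) mult.assoc mult.commute mult.right_neutral)
  qed (rule X_power_Suc_neq)
  note sh = this
  have "ceq N (\<Sum>s<N. fps_X ^ (s * (2 * N + 1)) * R s) (\<Sum>s<N. if s = 0 then 1 else 0)"
  proof (rule ceq_sum)
    fix s
    show "ceq N (fps_X ^ (s * (2 * N + 1)) * R s) (if s = 0 then 1 else 0)"
    proof (cases s)
      case (Suc m)
      have "fps_X ^ N dvd fps_X ^ (s * (2 * N + 1)) * R s"
        unfolding Suc by (intro dvd_mult2 le_imp_power_dvd) simp
      then show ?thesis by (simp add: ceq_def Suc)
    qed (simp add: R_def A_def B_def)
  qed
  then have "ceq N (\<Sum>s<N. fps_X ^ (s * (2 * N + 1)) * R s) 1"
    using False by simp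
  from ceq_multl[OF this, of "P N"] have 1: "ceq N (\<Sum>k<2 * N. fps_X ^ (k * (k + 1) div 2)) (P N)"
    unfolding sh by simp
  have "ceq N psi (\<Sum>k<2 * N. fps_const 1 * fps_X ^ (k * (k + 1) div 2))"
    unfolding psi_def
  proof (rule ceq_ser)
    fix k assume "k \<in> UNIV - {..<2 * N}"
    then have "2 * N \<le> k" by simp
    also have "k * 2 \<le> k * (k + 1)" using calculation False by (intro mult_le_mono2) auto
    then have "k * 2 div 2 \<le> k * (k + 1) div 2" by (rule div_le_mono)
    then have "k \<le> k * (k + 1) div 2" by simp
    finally show "N \<le> k * (k + 1) div 2" by simp
  qed auto
  then have "ceq N psi (P N)" using ceq_trans[OF _ 1] by simp
  then have "ceq N (A N * psi) (A N * P N)" by (rule ceq_multl)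
  moreover have "A N * P N = B N" unfolding P_def using i(1)[of N] by (simp add: mult.left_commute)
  ultimately show ?thesis by (simp add: A_def B_def mult.commute)
qed (simp add: ceq_nth)

lemma phim_product:
  "ceq N (phim * (\<Prod>k<N. 1 + fps_X ^ (k + 1))) (\<Prod>k<N. 1 - fps_X ^ (k + 1))"
proof -
  define A B :: "nat \<Rightarrow> rat fps" where "A n = (\<Prod>k<n. 1 + fps_X ^ (k + 1))"
    and "B n = (\<Prod>k<n. 1 - fps_X ^ (k + 1))" for n
  have 0: "A n $ 0 = 1" "B n $ 0 = 1" for n by (simp_all add: A_def B_def fps_prod_nth_0)
  have i: "A n * inverse (A n) = 1" "B n * inverse (B n) = 1" for n
    by (rule inverse_mult_eq_1', simp add: 0)+
  have S: "A (Suc n) = A n * (1 + fps_X ^ Suc n)" "B (Suc n) = B n * (1 - fps_X ^ Suc n)" for n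
    by (simp_all add: A_def B_def)
  define P R where "P n = B n * inverse (A n)" and "R n = A n * inverse (B n)" for n
  have iS: "inverse (A (Suc n)) * (1 + fps_X ^ Suc n) = inverse (A n)"
    "inverse (B (Suc n)) * (1 - fps_X ^ Suc n) = inverse (B n)" for n
    by (rule mult_inverse_cancel; simp add: S 0)+
  have "(1 - fps_X ^ Suc n) * (P n * (\<Sum>s\<le>n. (- 1) ^ s * fps_X ^ (s * Suc n) * R s))
    = 1 + 2 * (\<Sum>s=1..n. (- 1) ^ s * fps_X ^ s\<^sup>2) + (- 1) ^ Suc n * fps_X ^ (Suc n)\<^sup>2" for n
  proof (rule shanks_square)
    show "P 0 = 1" by (simp add: P_def A_def B_def)
    show "P (Suc n) * (1 + fps_X ^ Suc n) = P n * (1 - fps_X ^ Suc n)" for n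
      unfolding P_def iS(1)[of n, symmetric] S(2) by (simp only: mult_ac)
    show "R (Suc n) * (1 - fps_X ^ Suc n) = R n * (1 + fps_X ^ Suc n)" for n
      unfolding R_def iS(2)[of n, symmetric] S(1) by (simp only: mult_ac)
    show "P n * R n = 1" for n
      unfolding P_def R_def using i[of n] by (metis (no_types) mult.assoc mult.commute mult.right_neutral)
  qed (rule X_power_Suc_neq)
  note sh = this
  have "ceq N (\<Sum>s\<le>N. (- 1) ^ s * fps_X ^ (s * Suc N) * R s) (\<Sum>s\<le>N. if s = 0 then 1 else 0)"
  proof (rule ceq_sum)
    fix s
    show "ceq N ((- 1) ^ s * fps_X ^ (s * Suc N) * R s) (if s = 0 then 1 else 0)"
    proof (cases s)
      case (Suc m)
      have "fps_X ^ N dvd (- 1) ^ s * fps_X ^ (s * Suc N) * R s"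
        unfolding Suc by (intro dvd_mult dvd_mult2 le_imp_power_dvd) simp
      then show ?thesis by (simp add: ceq_def Suc)
    qed (simp add: R_def A_def B_def)
  qed
  then have "ceq N (\<Sum>s\<le>N. (- 1) ^ s * fps_X ^ (s * Suc N) * R s) 1" by simp
  then have "ceq N ((1 - fps_X ^ Suc N) * (P N * (\<Sum>s\<le>N. (- 1) ^ s * fps_X ^ (s * Suc N) * R s)))
      (1 * (P N * 1))"
    by (intro ceq_mult ceq_refl ceq_one_diff) simp_all
  then have 1: "ceq N (1 + 2 * (\<Sum>s=1..N. (- 1) ^ s * fps_X ^ s\<^sup>2) + (- 1) ^ Suc N * fps_X ^ (Suc N)\<^sup>2) (P N)"
    unfolding sh by simp
  have big: "fps_X ^ N dvd (- 1) ^ Suc N * fps_X ^ (Suc N)\<^sup>2 "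
    by (intro dvd_mult le_imp_power_dvd) (simp add: power2_eq_square)
  have "ceq N (1 + 2 * (\<Sum>s=1..N. (- 1) ^ s * fps_X ^ s\<^sup>2))
     (1 + 2 * (\<Sum>s=1..N. (- 1) ^ s * fps_X ^ s\<^sup>2) + (- 1) ^ Suc N * fps_X ^ (Suc N)\<^sup>2)"
  proof -
    have "ceq N 0 ((- 1) ^ Suc N * fps_X ^ (Suc N)\<^sup>2)"
      using big by (simp only: ceq_def diff_0 dvd_minus_iff)
    from ceq_add[OF ceq_refl this] show ?thesis by (simp only: add_0_right)
  qed
  from ceq_trans[OF this 1] have 2: "ceq N (1 + 2 * (\<Sum>s=1..N. (- 1) ^ s * fps_X ^ s\<^sup>2)) (P N)" .
  have "ceq N phim (\<Sum>x\<in>{- int N..int N}. fps_const (sg x) * fps_X ^ nat (x\<^sup>2))"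
    unfolding phim_def
  proof (rule ceq_ser)
    fix x assume "x \<in> UNIV - {- int N..int N}"
    then have "int N \<le> \<bar>x\<bar>" by auto
    also have "\<bar>x\<bar> \<le> x\<^sup>2" using self_le_power[of "\<bar>x\<bar>" 2] by (cases "x = 0") auto
    finally show "N \<le> nat (x\<^sup>2)" by simp
  qed auto
  also have "(\<Sum>x\<in>{- int N..int N}. fps_const (sg x) * fps_X ^ nat (x\<^sup>2))
      = 1 + 2 * (\<Sum>s=1..N. (- 1) ^ s * fps_X ^ s\<^sup>2)"
  proof (induction N)
    case (Suc N)
    have "{- int (Suc N)..int (Suc N)} = insert (- int (Suc N)) (insert (int (Suc N)) {- int N..int N})"
      by auto
    moreover have "fps_const (sg (int (Suc N))) = (- 1) ^ Suc N" "fps_const (sg (- int (Suc N))) = (- 1) ^ Suc N"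
      by (auto simp: sg_def fps_const_neg[symmetric] simp del: fps_const_neg)
    moreover have "nat ((int (Suc N))\<^sup>2) = (Suc N)\<^sup>2" "nat ((- int (Suc N))\<^sup>2) = (Suc N)\<^sup>2"
      by (simp_all add: nat_power_eq del: of_nat_Suc)
    ultimately show ?case using Suc by (simp del: of_nat_Suc)
  qed (simp add: sg_def)
  finally have "ceq N phim (P N)" using ceq_trans[OF _ 2] by simp
  then have "ceq N (A N * phim) (A N * P N)" by (rule ceq_multl)
  moreover have "A N * P N = B N" unfolding P_def using i(1)[of N] by (simp add: mult.left_commute)
  ultimately show ?thesis by (simp add: A_def B_def mult.commute)
qed

section \<open>The product identity for the generating function of b(2n)\<close>

lemma fps_nth_compose_square:
  "(F oo fps_X ^ 2) $ n = (if even n then F $ (n div 2) else (0 :: rat))"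
proof -
  have "(F oo fps_X ^ 2) $ n = (\<Sum>i=0..n. if n = 2 * i then F $ i else 0)"
    unfolding fps_compose_nth by (intro sum.cong) (auto simp flip: power_mult)
  also have "\<dots> = (\<Sum>i\<in>{0..n} \<inter> {i. n = 2 * i}. F $ i)"
    by (simp add: sum.inter_restrict)
  also have "{0..n} \<inter> {i. n = 2 * i} = (if even n then {n div 2} else {})"
    by auto
  finally show ?thesis by simp
qed

lemma ceq_compose_square:
  assumes "ceq N F G" shows "ceq N (F oo fps_X ^ 2) (G oo fps_X ^ 2)"
  using assms by (auto simp: ceq_nth fps_nth_compose_square)

definition evenB :: "rat fps" where
  "evenB = Abs_fps (\<lambda>n. b (2 * n))"

text \<open>\<open>bilat N 1\<close> doubles the even coefficients of B and kills the odd ones, so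
  it represents 2 E(q^2). Gauss' products are therefore taken at q^2, and the substitution is undone
  by comparing coefficients of even index.\<close>

lemma evenB_phim: "evenB * phim = psi ^ 2"
proof -
  let ?c = "\<lambda>F. F oo (fps_X ^ 2 :: rat fps)"
  have mult: "?c (F * G) = ?c F * ?c G" for F G
    by (rule fps_compose_mult_distrib) simp
  have X: "?c (fps_X ^ m) = fps_X ^ (2 * m)" for m
    by (simp add: power_mult flip: fps_compose_power)
  have prod_c: "?c (\<Prod>k<N. f k) = (\<Prod>k<N. ?c (f k))" for f :: "nat \<Rightarrow> rat fps" and N
    by (rule fps_compose_prod_distrib) simp
  have "ceq N (?c evenB * ?c phim) (?c psi ^ 2)" for N
  proof -
    let ?a = "\<Prod>k<N. 1 - fps_X ^ (4 * k + 2) :: rat fps"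
    let ?e = "\<Prod>k<N. 1 + fps_X ^ (2 * k + 2) :: rat fps"
    let ?d = "\<Prod>k<N. 1 - fps_X ^ (4 * k + 4) :: rat fps"
    let ?f = "\<Prod>k<N. 1 - fps_X ^ (2 * k + 2) :: rat fps"
    let ?E = "?c evenB"
    have "(1 - fps_X ^ (2 * k + 2)) * (1 + fps_X ^ (2 * k + 2)) = (1 - fps_X ^ (4 * k + 4) :: rat fps)" for k
    proof -
      have "fps_X ^ (4 * k + 4) = fps_X ^ (2 * k + 2) * (fps_X ^ (2 * k + 2) :: rat fps)"
        unfolding power_add[symmetric] by (rule arg_cong) simp
      then show ?thesis by (simp only: algebra_simps) simp
    qed
    then have fe: "?f * ?e = ?d"
      by (simp only: prod.distrib[symmetric])
    have e: "2 * (k + 1) = 2 * k + 2" "2 * (k + 2) = 2 * k + 4" "2 * (2 * k) = 4 * k" for k :: nat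
      by simp_all
    have psi: "ceq N (?c psi * ?a) ?d"
      using ceq_compose_square[OF psi_product[of N]]
      unfolding mult prod_c fps_compose_sub_distrib fps_compose_1 X e .
    have phi: "ceq N (?c phim * ?e) ?f"
      using ceq_compose_square[OF phim_product[of N]]
      unfolding mult prod_c fps_compose_sub_distrib fps_compose_add_distrib fps_compose_1 X e .
    have "ceq N (bilat N 1) (2 * ?E)"
      unfolding ceq_nth
    proof (intro allI impI)
      fix i assume "i < N"
      then show "bilat N 1 $ i = (2 * ?E) $ i"
        using bilat_1_nth[of i N] by (simp add: evenB_def numeral_fps_const fps_nth_compose_square)
    qed
    from ceq_mult[OF ceq_sym[OF this] ceq_refl, of "?a ^ 2"]
    have "ceq N (2 * ?E * ?a ^ 2) (2 * ?e ^ 2 * ?d)"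
      using bilat_1_product ceq_trans by blast
    from ceq_multl[OF this, of "?c phim"]
    have "ceq N (2 * ?a ^ 2 * (?E * ?c phim)) (2 * ?e * ?d * (?c phim * ?e))"
      by (simp add: power2_eq_square mult_ac)
    also have "ceq N \<dots> (2 * ?e * ?d * ?f)" by (intro ceq_multl phi)
    also have "2 * ?e * ?d * ?f = 2 * (?d * ?d)" unfolding fe[symmetric] by (simp only: mult_ac)
    also have "ceq N \<dots> (2 * ((?c psi * ?a) * (?c psi * ?a)))"
      by (intro ceq_mult ceq_refl ceq_sym[OF psi])
    also have "2 * ((?c psi * ?a) * (?c psi * ?a)) = 2 * ?a ^ 2 * ?c psi ^ 2"
      by (simp add: power2_eq_square mult_ac)
    finally show ?thesis
      by (rule ceq_cancel) (simp add: fps_power_zeroth fps_prod_nth_0 numeral_fps_const)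
  qed
  then have "?c (evenB * phim) = ?c (psi ^ 2)"
    unfolding power2_eq_square[of psi] mult by (intro ceq_eqI) (simp add: power2_eq_square)
  then have "?c (evenB * phim) $ (2 * n) = ?c (psi ^ 2) $ (2 * n)" for n
    by simp
  then show ?thesis
    by (intro fps_ext) (simp add: fps_nth_compose_square)
qed

section \<open>Theta series as sums over integers and their quadratic forms\<close>

definition sq :: "int \<Rightarrow> nat" where
  "sq x = nat (x\<^sup>2)"

text \<open>For odd x = 2k + 1 this is the triangular number k(k+1)/2. Indexing by odd integers of
  both signs counts each value twice but makes linear changes of variables available.\<close>

definition tri :: "int \<Rightarrow> nat" where
  "tri x = nat ((x\<^sup>2 - 1) div 8)"

lemma odd_square_int:
  assumes "odd (x :: int)" obtains j where "j \<ge> 0" "x\<^sup>2 = 8 * j + 1"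
proof -
  obtain k where k: "x = 2 * k + 1" using assms by (rule oddE)
  have "even (k * (k + 1))" by simp
  then obtain j where j: "k * (k + 1) = 2 * j" by (rule evenE)
  have x: "x\<^sup>2 = 8 * j + 1" unfolding k using j by (simp add: power2_eq_square algebra_simps)
  moreover have "j \<ge> 0" using x zero_le_power2[of x] by linarith
  ultimately show ?thesis using that by blast
qed

lemma abs_le_square: "\<bar>x\<bar> \<le> (x :: int)\<^sup>2"
  using self_le_power[of "\<bar>x\<bar>" 2] by (cases "x = 0") auto

lemma finite_fibres_int:
  assumes "\<And>x. x \<in> A \<Longrightarrow> x\<^sup>2 \<le> 8 * int (f x) + 8"
  shows "finite_fibres A f"
  unfolding finite_fibres_def
proof
  fix n
  have "{x \<in> A. f x = n} \<subseteq> {- (8 * int n + 8)..8 * int n + 8}"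
  proof
    fix x assume "x \<in> {x \<in> A. f x = n}"
    then have "\<bar>x\<bar> \<le> 8 * int n + 8" using assms[of x] abs_le_square[of x] by auto
    then show "x \<in> {- (8 * int n + 8)..8 * int n + 8}" by auto
  qed
  then show "finite {x \<in> A. f x = n}" by (rule finite_subset) simp
qed

lemma finite_fibres_sq: "finite_fibres A sq"
  by (rule finite_fibres_int) (simp add: sq_def)

lemma finite_fibres_tri: "A \<subseteq> {x. odd x} \<Longrightarrow> finite_fibres A tri"
  by (rule finite_fibres_int) (auto simp: tri_def elim!: odd_square_int dest!: subsetD)

text \<open>Products of a triangular and a square theta series thus become theta series of the form
  x^2 + 8 y^2, on which isometries act.\<close>

lemma tri_add_sq:
  assumes "odd x" shows "tri x + sq y = nat ((x\<^sup>2 + 8 * y\<^sup>2 - 1) div 8)"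
proof -
  obtain j where "j \<ge> 0" "x\<^sup>2 = 8 * j + 1" using assms by (rule odd_square_int)
  then show ?thesis by (simp add: tri_def sq_def nat_add_distrib)
qed

lemma ser_odd_symmetric:
  fixes f :: "int \<Rightarrow> nat"
  assumes "finite_fibres {x. odd x} f" "\<And>x. f (- x) = f x"
  shows "ser {x. odd x} f (\<lambda>_. 1) = 2 * ser UNIV (\<lambda>k. f (2 * int k + 1)) (\<lambda>_. 1)"
proof -
  have pos: "bij_betw (\<lambda>k. 2 * int k + 1) UNIV {x. odd x \<and> x > 0}"
    by (rule bij_betw_byWitness[where f' = "\<lambda>x. nat ((x - 1) div 2)"]) (auto elim!: oddE)
  have neg: "bij_betw (\<lambda>k. - (2 * int k + 1)) UNIV {x. odd x \<and> x < 0}"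
    by (rule bij_betw_byWitness[where f' = "\<lambda>x. nat ((- x - 1) div 2)"]) (auto elim!: oddE)
  have "{x :: int. odd x} = {x. odd x \<and> x > 0} \<union> {x. odd x \<and> x < 0}" (is "_ = ?P \<union> ?N")
    by (auto simp: not_less intro: ccontr)
  then have "ser {x. odd x} f (\<lambda>_. 1) = ser (?P \<union> ?N) f (\<lambda>_. 1)"
    by (rule arg_cong)
  also have "\<dots> = ser ?P f (\<lambda>_. 1) + ser ?N f (\<lambda>_. 1)"
    by (intro ser_Un finite_fibres_subset[OF assms(1)]) auto
  also have "ser {x. odd x \<and> x > 0} f (\<lambda>_. 1) = ser UNIV (\<lambda>k. f (2 * int k + 1)) (\<lambda>_. 1)"
    by (rule ser_reindex[OF pos]) auto
  also have "ser {x. odd x \<and> x < 0} f (\<lambda>_. 1) = ser UNIV (\<lambda>k. f (2 * int k + 1)) (\<lambda>_. 1)"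
    by (rule ser_reindex[OF neg]) (auto simp: assms(2) simp del: minus_add_distrib)
  finally show ?thesis by simp
qed

lemma ser_tri: "ser {x. odd x} tri (\<lambda>_. 1) = 2 * psi"
proof -
  have "tri (2 * int k + 1) = k * (k + 1) div 2" for k
  proof -
    have "((2 * int k + 1)\<^sup>2 - 1) = 4 * int (k * (k + 1))" by (simp add: power2_eq_square algebra_simps)
    then have "((2 * int k + 1)\<^sup>2 - 1) div 8 = int (k * (k + 1)) div 2" by simp
    then have "tri (2 * int k + 1) = nat (int (k * (k + 1) div 2))" unfolding tri_def by (simp only: of_nat_div of_nat_numeral)
    then show ?thesis by simp
  qed
  then show ?thesis
    by (subst ser_odd_symmetric) (auto simp: psi_def tri_def[of "- _"] tri_def[symmetric] intro!: finite_fibres_tri)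
qed

definition phi :: "rat fps" where
  "phi = ser UNIV sq (\<lambda>_. 1)"

definition psi2 :: "rat fps" where
  "psi2 = ser (UNIV :: nat set) (\<lambda>k. k * (k + 1)) (\<lambda>_. 1)"

text \<open>The map (x, y) -> (x + y, x - y) doubles x^2 + y^2 and sends pairs of opposite parity to
  pairs of odd integers. The even entry 2u yields phi, the odd entry 2 psi(q^2); with the two orders
  of the entries this matches the factor 4 of (2 psi)^2.\<close>

lemma psi_square: "psi ^ 2 = phi * psi2"
proof -
  define g :: "int \<Rightarrow> nat" where "g x = nat ((x\<^sup>2 - 1) div 4)" for x
  have fg: "finite_fibres {x. odd x} g"
    by (rule finite_fibres_int) (auto simp: g_def elim!: odd_square_int)
  have g_eq: "g (2 * int k + 1) = k * (k + 1)" for k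
  proof -
    have "((2 * int k + 1)\<^sup>2 - 1) = 4 * int (k * (k + 1))" by (simp add: power2_eq_square algebra_simps)
    then have "((2 * int k + 1)\<^sup>2 - 1) div 4 = int (k * (k + 1))" by simp
    then show ?thesis unfolding g_def by (simp only: nat_int)
  qed
  have Psi2: "ser {x. odd x} g (\<lambda>_. 1) = 2 * psi2"
    by (subst ser_odd_symmetric) (simp_all add: fg g_eq psi2_def g_def[of "- _"] g_def[symmetric])
  let ?F = "\<lambda>(x, y). tri x + tri y"
  let ?S = "{(x, y). odd (x + y)} :: (int \<times> int) set"
  let ?G = "\<lambda>(x :: int, y). nat ((x\<^sup>2 + y\<^sup>2 - 1) div 4)"
  have h: "bij_betw (\<lambda>(x, y). (x + y, x - y)) ?S ({x. odd x} \<times> {x. odd x} :: (int \<times> int) set)"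
    by (rule bij_betw_byWitness[where f' = "\<lambda>(x, y). ((x + y) div 2, (x - y) div 2)"])
      (auto elim!: oddE simp: algebra_simps)
  have ff: "finite_fibres ({x. odd x} \<times> {x. odd x}) ?F"
    by (intro finite_fibres_Times finite_fibres_tri) auto
  have FG: "?F (case z of (x, y) \<Rightarrow> (x + y, x - y)) = ?G z" if "z \<in> ?S" for z
  proof -
    obtain x y where "z = (x, y)" by (cases z)
    with that have z: "z = (x, y)" "odd (x + y)" by simp_all
    obtain i where i: "i \<ge> 0" "(x + y)\<^sup>2 = 8 * i + 1" using z(2) by (rule odd_square_int)
    have "odd (x - y)" using z(2) by simp
    then obtain j where j: "j \<ge> 0" "(x - y)\<^sup>2 = 8 * j + 1" by (rule odd_square_int)
    have "x\<^sup>2 + y\<^sup>2 = 4 * (i + j) + 1"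
      using i(2) j(2) by (simp add: power2_eq_square algebra_simps)
    then show ?thesis unfolding z using i j by (simp add: tri_def nat_add_distrib)
  qed
  have S1: "bij_betw (\<lambda>(u, v). (2 * u, v)) (UNIV \<times> {x. odd x}) {(x :: int, y :: int). even x \<and> odd y}"
    by (rule bij_betw_byWitness[where f' = "\<lambda>(x, y). (x div 2, y)"]) auto
  have S2: "bij_betw (\<lambda>(u, v). (v, 2 * u)) (UNIV \<times> {x. odd x}) {(x :: int, y :: int). odd x \<and> even y}"
    by (rule bij_betw_byWitness[where f' = "\<lambda>(x, y). (y div 2, x)"]) auto
  have G: "nat (((2 * u)\<^sup>2 + v\<^sup>2 - 1) div 4) = sq u + g v" "nat ((v\<^sup>2 + (2 * u)\<^sup>2 - 1) div 4) = sq u + g v"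
    if "odd v" for u v :: int
  proof -
    obtain i where i: "i \<ge> 0" "v\<^sup>2 = 8 * i + 1" using \<open>odd v\<close> by (rule odd_square_int)
    have "(2 * u)\<^sup>2 + v\<^sup>2 - 1 = 4 * (u\<^sup>2 + 2 * i)" "v\<^sup>2 + (2 * u)\<^sup>2 - 1 = 4 * (u\<^sup>2 + 2 * i)"
      "v\<^sup>2 - 1 = 4 * (2 * i)"
      using i(2) by (simp_all add: power_mult_distrib)
    then show "nat (((2 * u)\<^sup>2 + v\<^sup>2 - 1) div 4) = sq u + g v" "nat ((v\<^sup>2 + (2 * u)\<^sup>2 - 1) div 4) = sq u + g v"
      using i(1) unfolding sq_def g_def by (simp_all only: nat_add_distrib) (simp_all add: nat_add_distrib)
  qed
  have fibS: "finite_fibres ?S ?G"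
    by (rule finite_fibres_reindex[OF h ff]) (use FG in auto)
  have "(2 * psi) ^ 2 = ser ({x. odd x} \<times> {x. odd x}) ?F (\<lambda>(x, y). 1 * 1)"
    unfolding ser_tri[symmetric] power2_eq_square by (rule ser_mult) (auto intro!: finite_fibres_tri)
  also have "\<dots> = ser ?S ?G (\<lambda>_. 1)"
    by (rule ser_reindex[OF h]) (use FG in auto)
  also have "?S = {(x, y). even x \<and> odd y} \<union> {(x, y). odd x \<and> even y}" by auto
  also have "ser \<dots> ?G (\<lambda>_. 1) = ser {(x, y). even x \<and> odd y} ?G (\<lambda>_. 1) + ser {(x, y). odd x \<and> even y} ?G (\<lambda>_. 1)"
    by (intro ser_Un finite_fibres_subset[OF fibS]) auto
  also have "ser {(x, y). even x \<and> odd y} ?G (\<lambda>_. 1) = ser (UNIV \<times> {x. odd x}) (\<lambda>(u, v). sq u + g v) (\<lambda>(x, y). 1 * 1)"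
    by (rule ser_reindex[OF S1]) (use G in auto)
  also have "ser {(x, y). odd x \<and> even y} ?G (\<lambda>_. 1) = ser (UNIV \<times> {x. odd x}) (\<lambda>(u, v). sq u + g v) (\<lambda>(x, y). 1 * 1)"
    by (rule ser_reindex[OF S2]) (use G in auto)
  also have "ser (UNIV \<times> {x. odd x}) (\<lambda>(u, v). sq u + g v) (\<lambda>(x, y). 1 * 1) = phi * (2 * psi2)"
    unfolding phi_def Psi2[symmetric] by (rule ser_mult[symmetric, OF finite_fibres_sq fg])
  finally have "4 * psi ^ 2 = 4 * (phi * psi2)" by (simp add: power_mult_distrib algebra_simps)
  then show ?thesis by simp
qed

section \<open>Divisibility of coefficients\<close>

definition multiples :: "int \<Rightarrow> rat set" where
  "multiples d = range (\<lambda>m. of_int (d * m))"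

lemma multiples_0 [simp]: "0 \<in> multiples d"
  unfolding multiples_def by (rule image_eqI[of _ _ 0]) auto

lemma multiples_add: "x \<in> multiples d \<Longrightarrow> y \<in> multiples d \<Longrightarrow> x + y \<in> multiples d"
  unfolding multiples_def by (auto simp flip: of_int_add distrib_left)

lemma multiples_mult: "x \<in> multiples d \<Longrightarrow> y \<in> multiples e \<Longrightarrow> x * y \<in> multiples (d * e)"
  unfolding multiples_def by (auto simp: mult_ac intro!: image_eqI[of _ _ "_ * _"])

lemma multiples_uminus: "x \<in> multiples d \<Longrightarrow> - x \<in> multiples d"
  unfolding multiples_def by (auto intro!: image_eqI[of _ _ "- _"])

lemma multiples_sum: "(\<And>i. i \<in> A \<Longrightarrow> f i \<in> multiples d) \<Longrightarrow> sum f A \<in> multiples d"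
  by (induction A rule: infinite_finite_induct) (auto intro: multiples_add)

definition integral_fps :: "rat fps \<Rightarrow> bool" where
  "integral_fps F \<longleftrightarrow> (\<forall>n. F $ n \<in> multiples 1)"

lemma integral_fps_add: "integral_fps F \<Longrightarrow> integral_fps G \<Longrightarrow> integral_fps (F + G)"
  by (simp add: integral_fps_def multiples_add)

lemma integral_fps_uminus: "integral_fps F \<Longrightarrow> integral_fps (- F)"
  by (simp add: integral_fps_def multiples_uminus)

lemma integral_fps_diff: "integral_fps F \<Longrightarrow> integral_fps G \<Longrightarrow> integral_fps (F - G)"
  using integral_fps_add[OF _ integral_fps_uminus] by fastforce

lemma integral_fps_mult: "integral_fps F \<Longrightarrow> integral_fps G \<Longrightarrow> integral_fps (F * G)"
  using multiples_mult[of _ 1 _ 1] by (auto simp: integral_fps_def fps_mult_nth intro!: multiples_sum)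

lemma integral_fps_numeral_mult: "integral_fps F \<Longrightarrow> integral_fps (numeral m * F)"
  using multiples_mult[of "numeral m" 1 _ 1]
  by (auto simp: integral_fps_def numeral_fps_const multiples_def image_iff intro: exI[of _ "numeral m"])

lemma integral_ser:
  assumes "\<And>x. x \<in> A \<Longrightarrow> w x \<in> multiples 1" shows "integral_fps (ser A f w)"
  using assms by (auto simp: integral_fps_def ser_nth intro!: multiples_sum)

lemma multiples_units: "1 \<in> multiples 1" "sg x \<in> multiples 1"
  by (auto simp: multiples_def sg_def intro: image_eqI[of _ _ 1] image_eqI[of _ _ "- 1"])

definition supp_mod :: "nat \<Rightarrow> nat \<Rightarrow> rat fps \<Rightarrow> bool" where
  "supp_mod k c F \<longleftrightarrow> (\<forall>n. F $ n \<noteq> 0 \<longrightarrow> n mod k = c mod k)"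

lemma supp_mod_add: "supp_mod k c F \<Longrightarrow> supp_mod k c G \<Longrightarrow> supp_mod k c (F + G)"
  by (auto simp: supp_mod_def) (metis add_cancel_right_left)

lemma supp_mod_uminus: "supp_mod k c F \<Longrightarrow> supp_mod k c (- F)"
  by (auto simp: supp_mod_def)

lemma supp_mod_mult:
  assumes "supp_mod k c F" "supp_mod k d G" shows "supp_mod k (c + d) (F * G)"
  unfolding supp_mod_def
proof (intro allI impI)
  fix n assume "(F * G) $ n \<noteq> 0"
  then obtain i where i: "i \<le> n" "F $ i * G $ (n - i) \<noteq> 0"
    unfolding fps_mult_nth by (meson atLeastAtMost_iff sum.not_neutral_contains_not_neutral)
  then have "i mod k = c mod k" "(n - i) mod k = d mod k"
    using assms by (auto simp: supp_mod_def)
  then have "(i + (n - i)) mod k = (c + d) mod k" by (metis mod_add_eq)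
  then show "n mod k = (c + d) mod k" using i by simp
qed

lemma supp_mod_cong: "supp_mod k c F \<Longrightarrow> c mod k = d mod k \<Longrightarrow> supp_mod k d F"
  by (simp add: supp_mod_def)

lemma supp_mod_const_mult: "supp_mod k c F \<Longrightarrow> supp_mod k c (numeral m * F)"
  by (auto simp: supp_mod_def numeral_fps_const)

lemma supp_mod_ser:
  assumes "\<And>x. x \<in> A \<Longrightarrow> f x mod k = c mod k" shows "supp_mod k c (ser A f w)"
  unfolding supp_mod_def ser_nth
proof (intro allI impI, rule ccontr)
  fix n assume "(\<Sum>x\<in>{x \<in> A. f x = n}. w x) \<noteq> 0" "n mod k \<noteq> c mod k"
  moreover from this(2) have "{x \<in> A. f x = n} = {}" using assms by auto
  ultimately show False by simp
qed

text \<open>Since G lives on multiples of k, coefficient n of F G involves only those F $ i with i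
  congruent to n modulo k. As G $ 0 = 1, F $ n can be solved for recursively inside its own residue
  class.\<close>

lemma multiples_of_mult:
  assumes G: "supp_mod k 0 G" "integral_fps G" "G $ 0 = 1"
    and FG: "\<And>n. n mod k = c \<Longrightarrow> (F * G) $ n \<in> multiples d"
  shows "n mod k = c \<Longrightarrow> F $ n \<in> multiples d"
proof (induction n rule: less_induct)
  case (less n)
  have "F $ i * G $ (n - i) \<in> multiples d" if "i < n" for i
  proof (cases "G $ (n - i) = 0")
    case False
    then have "k dvd n - i" using G(1) by (auto simp: supp_mod_def)
    then have "i mod k = c" using less.prems that by (metis dvd_minus_mod less_or_eq_imp_le mod_eq_dvd_iff_nat)
    then have "F $ i \<in> multiples d" using less.IH that by blast
    then show ?thesis using multiples_mult[of _ d _ 1] G(2) by (simp add: integral_fps_def)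
  qed simp
  then have S: "(\<Sum>i<n. F $ i * G $ (n - i)) \<in> multiples d" by (intro multiples_sum) auto
  have "(F * G) $ n = (\<Sum>i<n. F $ i * G $ (n - i)) + F $ n"
    using G(3) by (simp add: fps_mult_nth atLeast0AtMost lessThan_Suc_atMost[symmetric])
  then have "F $ n = (F * G) $ n + - (\<Sum>i<n. F $ i * G $ (n - i))" by simp
  then show ?case using multiples_add[OF FG[OF less.prems] multiples_uminus[OF S]] by simp
qed

section \<open>Congruences modulo 8 and 9\<close>

lemma evenB_mod_8:
  assumes "even n" "\<nexists>x :: nat. x\<^sup>2 = 4 * n + 1"
  shows "evenB $ n \<in> multiples 8"
proof -
  define e where "e = ser {x. even x} sq (\<lambda>_. 1)"
  define o1 where "o1 = ser {x. odd x} sq (\<lambda>_. 1)"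
  define o' :: "rat fps" where "o' = ser UNIV (\<lambda>k. sq (2 * int k + 1)) (\<lambda>_. 1)"
  have UN: "(UNIV :: int set) = {x. even x} \<union> {x. odd x}" by auto
  have phi: "phi = e + o1"
    unfolding phi_def e_def o1_def UN by (intro ser_Un finite_fibres_sq) auto
  have "phim = ser {x. even x} sq sg + ser {x. odd x} sq sg"
    unfolding phim_def sq_def[symmetric] UN by (intro ser_Un finite_fibres_sq) auto
  also have "ser {x. even x} sq sg = e"
    unfolding e_def by (rule ser_reindex[OF bij_betw_id]) (auto simp: sg_def)
  also have "ser {x. odd x} sq sg = ser {x. odd x} sq (\<lambda>_. - 1)"
    by (rule ser_reindex[OF bij_betw_id]) (auto simp: sg_def)
  also have "\<dots> = - o1" unfolding o1_def by (rule ser_uminus)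
  finally have phim: "phim = e - o1" by simp
  \<comment> \<open>Pairing x with -x gives the factor 2 whose square turns 2 o1^2 into 8
    o'^2.\<close>
  have o1: "o1 = 2 * o'"
    unfolding o1_def o'_def by (intro ser_odd_symmetric finite_fibres_sq) (simp add: sq_def)
  have supp: "supp_mod 2 0 e" "supp_mod 2 1 o1" "supp_mod 2 0 psi2"
  proof -
    have "sq x mod 2 = (if even x then 0 else 1)" for x by (simp add: sq_def even_nat_iff mod2_eq_if)
    then show "supp_mod 2 0 e" "supp_mod 2 1 o1"
      unfolding e_def o1_def by (auto intro!: supp_mod_ser)
    show "supp_mod 2 0 psi2"
      unfolding psi2_def by (rule supp_mod_ser) simp
  qed
  have int: "integral_fps e" "integral_fps o1" "integral_fps o'" "integral_fps psi2"
    unfolding e_def o1_def o'_def psi2_def by (auto intro!: integral_ser multiples_units)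
  \<comment> \<open>This is phi(q) phi(-q), an even function of q.\<close>
  let ?G = "e\<^sup>2 - o1\<^sup>2"
  have key: "(evenB - psi2) * ?G = 2 * (e * o1 * psi2) + 8 * (o'\<^sup>2 * psi2)"
  proof -
    have "evenB * ?G = (evenB * phim) * (e + o1)"
      unfolding phim by (simp add: power2_eq_square algebra_simps)
    also have "\<dots> = (e + o1) ^ 2 * psi2"
      unfolding evenB_phim psi_square phi by (simp add: power2_eq_square mult_ac)
    finally have "(evenB - psi2) * ?G = 2 * (e * o1 * psi2) + 2 * (o1\<^sup>2 * psi2)"
      by (simp add: power2_eq_square algebra_simps)
    then show ?thesis unfolding o1 by (simp add: power_mult_distrib)
  qed
  have odd_part: "supp_mod 2 1 (e * o1 * psi2)"
    using supp_mod_mult[OF supp_mod_mult[OF supp(1,2)] supp(3)] by simp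
  have "(evenB - psi2) $ n \<in> multiples 8"
  proof (rule multiples_of_mult[of 2 ?G 0])
    show "supp_mod 2 0 ?G"
      unfolding diff_conv_add_uminus power2_eq_square
      using supp_mod_mult[OF supp(1,1)] supp_mod_mult[OF supp(2,2)]
      by (intro supp_mod_add supp_mod_uminus) (auto elim: supp_mod_cong)
    show "integral_fps ?G"
      unfolding power2_eq_square by (intro integral_fps_diff integral_fps_mult int)
    have "{x. even x \<and> sq x = 0} = {0}" by (auto simp: sq_def)
    then have "e $ 0 = 1" by (simp add: e_def ser_nth)
    moreover have "o1 $ 0 = 0" using supp(2) by (auto simp: supp_mod_def)
    ultimately show "?G $ 0 = 1" by (simp add: power2_eq_square)
    fix m :: nat assume m: "m mod 2 = 0"
    have "(e * o1 * psi2) $ m = 0" using odd_part m by (auto simp: supp_mod_def)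
    then have "((evenB - psi2) * ?G) $ m = 8 * (o'\<^sup>2 * psi2) $ m"
      unfolding key by (simp add: numeral_fps_const)
    moreover have "integral_fps (o'\<^sup>2 * psi2)"
      unfolding power2_eq_square by (intro integral_fps_mult int)
    moreover have "8 \<in> multiples 8" unfolding multiples_def by (rule image_eqI[of _ _ 1]) auto
    ultimately show "((evenB - psi2) * ?G) $ m \<in> multiples 8"
      using multiples_mult[of 8 8 _ 1] by (simp add: integral_fps_def)
  qed (use assms(1) in auto)
  moreover have "psi2 $ n = 0"
  proof -
    have "k * (k + 1) \<noteq> n" for k
    proof
      assume "k * (k + 1) = n"
      then have "(2 * k + 1)\<^sup>2 = 4 * n + 1" by (simp add: power2_eq_square algebra_simps)
      then show False using assms(2) by blast
    qed
    then show ?thesis unfolding psi2_def ser_nth by (intro sum.neutral) auto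
  qed
  ultimately show ?thesis by simp
qed

lemma mod_3_cases: "(x :: int) mod 3 = 0 \<or> x mod 3 = 1 \<or> x mod 3 = 2"
  by presburger

lemma square_mod_3: "(x :: int)\<^sup>2 mod 3 = (if 3 dvd x then 0 else 1)"
proof -
  have "x\<^sup>2 mod 3 = (x mod 3)\<^sup>2 mod 3" by (simp add: power_mod)
  then show ?thesis using mod_3_cases[of x] by auto
qed

lemma evenB_mod_9:
  assumes "n mod 3 = 2" shows "evenB $ n \<in> multiples 9"
proof -
  let ?Odd = "\<lambda>c. {x :: int. odd x \<and> x mod 3 = c}"
  let ?All = "\<lambda>c. {x :: int. x mod 3 = c}"
  define A where "A = ser (?Odd 1) tri (\<lambda>_. 1)"
  define C where "C = ser (?Odd 0) tri (\<lambda>_. 1)"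
  define H where "H = ser (?All 0) sq sg"
  define U where "U = ser (?All 1) sq sg"
  have neg: "bij_betw uminus (?Odd 1) (?Odd 2)" "bij_betw uminus (?All 1) (?All 2)"
    by (rule bij_betw_byWitness[where f' = uminus]; auto; presburger)+
  have A': "ser (?Odd 2) tri (\<lambda>_. 1) = A"
    unfolding A_def by (rule ser_reindex[OF neg(1)]) (auto simp: tri_def)
  have U': "ser (?All 2) sq sg = U"
    unfolding U_def by (rule ser_reindex[OF neg(2)]) (auto simp: sq_def sg_def)
  have ft: "finite_fibres (?Odd c) tri" for c by (rule finite_fibres_tri) auto
  note fs = finite_fibres_sq
  have psi: "2 * psi = C + 2 * A"
  proof -
    have "{x :: int. odd x} = ?Odd 0 \<union> (?Odd 1 \<union> ?Odd 2)" using mod_3_cases by blast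
    then have "2 * psi = ser (?Odd 0 \<union> (?Odd 1 \<union> ?Odd 2)) tri (\<lambda>_. 1)"
      unfolding ser_tri[symmetric] by simp
    also have "\<dots> = ser (?Odd 0) tri (\<lambda>_. 1) + (ser (?Odd 1) tri (\<lambda>_. 1) + ser (?Odd 2) tri (\<lambda>_. 1))"
      by (subst ser_Un, (rule finite_fibres_tri, force)+, force, subst ser_Un) (auto intro: ft)
    finally show ?thesis unfolding A' by (simp add: A_def C_def)
  qed
  have phim: "phim = H + 2 * U"
  proof -
    have "(UNIV :: int set) = ?All 0 \<union> (?All 1 \<union> ?All 2)" using mod_3_cases by blast
    then have "phim = ser (?All 0 \<union> (?All 1 \<union> ?All 2)) sq sg"
      unfolding phim_def sq_def[symmetric] by simp
    also have "\<dots> = ser (?All 0) sq sg + (ser (?All 1) sq sg + ser (?All 2) sq sg)"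
      by (subst ser_Un, rule fs, rule fs, force, subst ser_Un) (auto intro: fs)
    finally show ?thesis unfolding U' by (simp add: U_def H_def)
  qed
  have CH: "C * H = - 2 * (A * U)"
  proof -
    let ?F = "\<lambda>(x, y). tri x + sq y"
    let ?W = "\<lambda>(x :: int, y). 1 * sg y"
    let ?P = "{(t, y). odd (t + y)} :: (int \<times> int) set"
    have prod: "ser (?Odd c \<times> ?All d) ?F ?W = ser (?Odd c) tri (\<lambda>_. 1) * ser (?All d) sq sg" for c d
      by (rule ser_mult[symmetric, OF ft fs])
    have fF: "finite_fibres ({x. odd x} \<times> UNIV) ?F"
      by (intro finite_fibres_Times finite_fibres_tri fs) auto
    have Un3: "ser (?Odd 0 \<times> ?All 0 \<union> (?Odd 1 \<times> ?All c \<union> ?Odd 2 \<times> ?All d)) ?F ?W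
        = C * H + (A * ser (?All c) sq sg + A * ser (?All d) sq sg)" for c d
      unfolding A_def A'[unfolded A_def, symmetric] C_def H_def prod[symmetric]
      by (subst ser_Un, (rule finite_fibres_subset[OF fF], force)+, force,
          subst ser_Un, (rule finite_fibres_subset[OF fF], force)+, force)
         (simp only: prod A' A_def[symmetric])
    \<comment> \<open>Class 0 is paired with class 0, and nonzero classes are paired in two ways. As
      A and U each represent both nonzero classes, the two lattices have the same sum C H + 2 A
      U.\<close>
    let ?L = "{(x :: int, y). odd x \<and> (x + y) mod 3 = 0}"
    let ?L' = "{(x :: int, y). odd x \<and> (x - y) mod 3 = 0}"
    have "?L = ?Odd 0 \<times> ?All 0 \<union> (?Odd 1 \<times> ?All 2 \<union> ?Odd 2 \<times> ?All 1)"
      by auto presburger+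
    then have L: "ser ?L ?F ?W = C * H + 2 * (A * U)"
      using Un3[of 2 1] U' by (simp add: U_def)
    have "?L' = ?Odd 0 \<times> ?All 0 \<union> (?Odd 1 \<times> ?All 1 \<union> ?Odd 2 \<times> ?All 2)"
      by auto presburger+
    then have L': "ser ?L' ?F ?W = C * H + 2 * (A * U)"
      using Un3[of 1 2] U' by (simp add: U_def)
    (* In terms of x + 2 y sqrt(-2), with exponent form x^2 + 8 y^2, multiplication by the norm-one
       element (1 + 2 sqrt(-2)) / 3 maps ?L to ?L' and flips the sign; (t, y) parametrizes both lattices. *)
    let ?G = "\<lambda>(t :: int, y). nat ((9 * t\<^sup>2 - 6 * t * y + 9 * y\<^sup>2 - 1) div 8)"
    have h: "bij_betw (\<lambda>(t, y). (3 * t - y, y)) ?P ?L"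
      by (rule bij_betw_byWitness[where f' = "\<lambda>(x, y). ((x + y) div 3, y)"]) (auto; presburger)+
    have h': "bij_betw (\<lambda>(t, y). (t - 3 * y, t)) ?P ?L'"
      by (rule bij_betw_byWitness[where f' = "\<lambda>(x, y). (y, (y - x) div 3)"]) (auto; presburger)+
    have "ser ?L ?F ?W = ser ?P ?G (\<lambda>(t, y). sg y)"
    proof (rule ser_reindex[OF h])
      fix z assume "z \<in> ?P"
      then obtain t y where z: "z = (t, y)" "odd (t + y)" by auto
      then have "odd (3 * t - y)" by simp
      from tri_add_sq[OF this, of y] show "?F (case z of (t, y) \<Rightarrow> (3 * t - y, y)) = ?G z"
        unfolding z by (simp add: power2_eq_square algebra_simps)
    qed auto
    \<comment> \<open>On \<open>?P\<close> the sum t + y is odd, so the weight sg t of the second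
      parametrization is the negative of sg y.\<close>
    moreover have "ser ?L' ?F ?W = ser ?P ?G (\<lambda>z. - (case z of (t, y) \<Rightarrow> sg y))"
    proof (rule ser_reindex[OF h'])
      fix z assume "z \<in> ?P"
      then obtain t y where z: "z = (t, y)" "odd (t + y)" by auto
      then have "odd (t - 3 * y)" by simp
      from tri_add_sq[OF this, of t] show "?F (case z of (t, y) \<Rightarrow> (t - 3 * y, t)) = ?G z"
        unfolding z by (simp add: power2_eq_square algebra_simps)
    qed (auto simp: sg_def)
    ultimately have "C * H + 2 * (A * U) = - (C * H + 2 * (A * U))"
      unfolding L L' ser_uminus by simp
    then have "2 * (C * H + 2 * (A * U)) = 0" by (simp add: algebra_simps)
    then have "C * H + 2 * (A * U) = 0" by (simp only: mult_eq_0_iff) simp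
    then show ?thesis by (simp add: add_eq_0_iff2)
  qed
  have supp: "supp_mod 3 0 A" "supp_mod 3 1 C" "supp_mod 3 0 H" "supp_mod 3 1 U"
  proof -
    \<comment> \<open>From x^2 = 8j + 1 and 8 = -1 modulo 3 follows j = 1 - x^2 modulo 3.\<close>
    have tri3: "int (tri x) mod 3 = (if 3 dvd x then 1 else 0)" if "odd x" for x
    proof -
      obtain j where j: "j \<ge> 0" "x\<^sup>2 = 8 * j + 1" using \<open>odd x\<close> by (rule odd_square_int)
      have "(8 * j + 1) mod 3 = (if 3 dvd x then 0 else 1)" using square_mod_3[of x] j by simp
      moreover have "int (tri x) = j" using j by (simp add: tri_def)
      ultimately show ?thesis by (auto split: if_splits) presburger+
    qed
    have sq3: "int (sq x) mod 3 = (if 3 dvd x then 0 else 1)" for x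
      by (simp add: sq_def square_mod_3)
    have int3: "m mod 3 = c mod 3" if "int m mod 3 = int (c mod 3)" for m c :: nat
      using that by (metis of_nat_eq_iff of_nat_mod of_nat_numeral)
    show "supp_mod 3 0 A" unfolding A_def
      by (rule supp_mod_ser, rule int3) (auto simp: tri3)
    show "supp_mod 3 1 C" unfolding C_def
      by (rule supp_mod_ser, rule int3) (auto simp: tri3)
    show "supp_mod 3 0 H" unfolding H_def
      by (rule supp_mod_ser, rule int3) (auto simp: sq3)
    show "supp_mod 3 1 U" unfolding U_def
      by (rule supp_mod_ser, rule int3) (auto simp: sq3)
  qed
  have int: "integral_fps A" "integral_fps H" "integral_fps U"
    unfolding A_def H_def U_def by (auto intro!: integral_ser multiples_units)
  \<comment> \<open>The norm of phi(-q) = H + 2U: a cube root of unity in q fixes H and rescales U,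
    and the other two conjugates multiply to H^2 - 2 H U + 4 U^2.\<close>
  let ?G = "H ^ 3 + 8 * U ^ 3"
  let ?S0 = "4 * (A * A * H * H) + 20 * (A * C * U * U)"
  let ?S1 = "4 * (C * C * U * U) - 16 * (A * A * H * U)"
  \<comment> \<open>The factor 4 allows the use of 2 psi = C + 2 A. \<open>?S0\<close> and
    \<open>?S1\<close> collect exponents 0 and 1 modulo 3 after C H is eliminated. In class 2 the
    terms 16 A^2 U^2, -8 A C H U and C^2 H^2 become 16 + 16 + 4 = 36 times A^2 U^2.\<close>
  have key: "4 * (evenB * ?G) = ?S0 + ?S1 + 36 * (A\<^sup>2 * U\<^sup>2)"
  proof -
    have "4 * (evenB * ?G) = 4 * (evenB * phim) * (H\<^sup>2 - 2 * H * U + 4 * U\<^sup>2)"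
      unfolding phim by (simp add: power2_eq_square power3_eq_cube algebra_simps)
    also have "\<dots> = (2 * psi)\<^sup>2 * (H\<^sup>2 - 2 * H * U + 4 * U\<^sup>2)"
      unfolding evenB_phim by (simp add: power_mult_distrib)
    also have "\<dots> = ?S0 + ?S1 + 36 * (A\<^sup>2 * U\<^sup>2)"
    proof -
      have "(C + 2 * A)\<^sup>2 * (H\<^sup>2 - 2 * H * U + 4 * U\<^sup>2)
          = 4 * (A * A * H * H) + 16 * (A * C * U * U) + 4 * (C * C * U * U) - 8 * (A * A * H * U)
            + 16 * (A\<^sup>2 * U\<^sup>2) + (C * H) * (C * H) + 4 * A * H * (C * H)
            - 8 * A * U * (C * H) - 2 * C * U * (C * H)"
        by (simp add: power2_eq_square algebra_simps)
      then show ?thesis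
        unfolding psi CH by (simp add: power2_eq_square algebra_simps)
    qed
    finally show ?thesis .
  qed
  have S0: "supp_mod 3 0 ?S0"
  proof (intro supp_mod_add supp_mod_const_mult)
    show "supp_mod 3 0 (A * A * H * H)"
      using supp_mod_mult[OF supp_mod_mult[OF supp_mod_mult[OF supp(1,1)] supp(3)] supp(3)] by simp
    show "supp_mod 3 0 (A * C * U * U)"
      using supp_mod_mult[OF supp_mod_mult[OF supp_mod_mult[OF supp(1,2)] supp(4)] supp(4)]
      by (rule supp_mod_cong) simp
  qed
  have S1: "supp_mod 3 1 ?S1"
    unfolding diff_conv_add_uminus
  proof (intro supp_mod_add supp_mod_uminus supp_mod_const_mult)
    show "supp_mod 3 1 (C * C * U * U)"
      using supp_mod_mult[OF supp_mod_mult[OF supp_mod_mult[OF supp(2,2)] supp(4)] supp(4)]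
      by (rule supp_mod_cong) simp
    show "supp_mod 3 1 (A * A * H * U)"
      using supp_mod_mult[OF supp_mod_mult[OF supp_mod_mult[OF supp(1,1)] supp(3)] supp(4)] by simp
  qed
  show ?thesis
  proof (rule multiples_of_mult[of 3 ?G 2])
    show "supp_mod 3 0 ?G"
      unfolding power3_eq_cube
      using supp_mod_mult[OF supp_mod_mult[OF supp(3,3)] supp(3)]
        supp_mod_mult[OF supp_mod_mult[OF supp(4,4)] supp(4)]
      by (intro supp_mod_add supp_mod_const_mult) (auto elim: supp_mod_cong)
    show "integral_fps ?G"
      unfolding power3_eq_cube
      by (intro integral_fps_add integral_fps_numeral_mult integral_fps_mult int)
    have "{x. x mod 3 = 0 \<and> sq x = 0} = {0}" by (auto simp: sq_def)
    then have "H $ 0 = 1" by (simp add: H_def ser_nth sg_def)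
    moreover have "U $ 0 = 0" using supp(4) by (auto simp: supp_mod_def)
    ultimately show "?G $ 0 = 1" by (simp add: power3_eq_cube)
    fix m :: nat assume m: "m mod 3 = 2"
    have "?S0 $ m = 0" "?S1 $ m = 0" using S0 S1 m by (auto simp: supp_mod_def)
    then have "(4 * (evenB * ?G)) $ m = (36 * (A\<^sup>2 * U\<^sup>2)) $ m"
      unfolding key by simp
    then have "(evenB * ?G) $ m = 9 * (A\<^sup>2 * U\<^sup>2) $ m"
      by (simp add: numeral_fps_const)
    moreover have "integral_fps (A\<^sup>2 * U\<^sup>2)"
      unfolding power2_eq_square by (intro integral_fps_mult int)
    moreover have "9 \<in> multiples 9" unfolding multiples_def by (rule image_eqI[of _ _ 1]) auto
    ultimately show "(evenB * ?G) $ m \<in> multiples 9"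
      using multiples_mult[of 9 9 _ 1] by (simp add: integral_fps_def)
  qed (fact assms)
qed

theorem theorem1p13:
  fixes p n k :: nat
  assumes "prime p" and "p \<ge> 3"
  shows "\<exists>m::int. b (108 * p ^ (2 * nu p * k) * n + (153 * p ^ (2 * nu p * k) - 1) div 2)
                   = of_int (72 * m)"
proof -
  define s where "s = p ^ (nu p * k)"
  have s2: "p ^ (2 * nu p * k) = s\<^sup>2" by (simp add: s_def mult.commute mult.left_commute flip: power_mult)
  have "odd p" using assms prime_odd_nat by force
  then have "odd s" by (simp add: s_def)
  then have "odd (int s)" by simp
  then obtain j' where "j' \<ge> 0" "(int s)\<^sup>2 = 8 * j' + 1" by (rule odd_square_int)
  then have "int (s\<^sup>2) = int (8 * nat j' + 1)" by simp
  then obtain j where j: "s\<^sup>2 = 8 * j + 1" using of_nat_eq_iff by blast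
  \<comment> \<open>Half the index: with s^2 = 8j + 1, (153 s^2 - 1) / 2 equals 612 j + 76. The
    constants 54, 306 and 38 are even, and 38 leaves remainder 2 modulo 3.\<close>
  define m where "m = 54 * s\<^sup>2 * n + 306 * j + 38"
  have N: "108 * p ^ (2 * nu p * k) * n + (153 * p ^ (2 * nu p * k) - 1) div 2 = 2 * m"
    unfolding s2 m_def j by simp
  have m4: "4 * m + 1 = (3 * s)\<^sup>2 * (24 * n + 17)"
    unfolding m_def power_mult_distrib j by (simp add: algebra_simps)
  have "\<nexists>x :: nat. x\<^sup>2 = 4 * m + 1"
  proof
    assume "\<exists>x :: nat. x\<^sup>2 = 4 * m + 1"
    then obtain x :: nat where x: "x\<^sup>2 = (3 * s)\<^sup>2 * (24 * n + 17)" unfolding m4 by blast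
    then have "(3 * s)\<^sup>2 dvd x\<^sup>2" by simp
    then have "3 * s dvd x" using pow_divides_pow_iff[of 2 "3 * s" x] by simp
    then obtain y where y: "x = 3 * s * y" by (rule dvdE)
    have "s > 0" using \<open>odd s\<close> by (cases s) auto
    then have "y\<^sup>2 = 24 * n + 17" using x unfolding y power_mult_distrib by simp
    then have "(int y)\<^sup>2 = 24 * int n + 17" by (metis of_nat_add of_nat_mult of_nat_numeral of_nat_power)
    then have "(24 * int n + 17) mod 3 = (if 3 dvd int y then 0 else 1)" using square_mod_3[of "int y"] by simp
    then show False by (auto split: if_splits) presburger+
  qed
  moreover have "even m" by (simp add: m_def)
  ultimately have 8: "b (2 * m) \<in> multiples 8" using evenB_mod_8[of m] by (simp add: evenB_def)
  have "m = 3 * (18 * s\<^sup>2 * n + 102 * j + 12) + 2" by (simp add: m_def)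
  then have "m mod 3 = 2" by (simp only: mod_mult_self4) simp
  then have 9: "b (2 * m) \<in> multiples 9" using evenB_mod_9[of m] by (simp add: evenB_def)
  from 8 9 obtain u v where u: "b (2 * m) = of_int (8 * u)" and v: "b (2 * m) = of_int (9 * v)"
    by (auto simp: multiples_def)
  then have "8 * u = 9 * v" by (metis of_int_eq_iff)
  \<comment> \<open>Coprimality made explicit by 1 = 9 - 8: 8u = 9 (8u) - 8 (9v).\<close>
  then have "8 * u = 72 * (u - v)" by simp
  then show ?thesis unfolding N u by metis
qed

end
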